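(* Let $\kappa$ be a regular cardinal such that $\kappa^{<\kappa}=\kappa$. Suppose that $\mathbb{P}$ is a $\kappa$-lattice and $\kappa$-strongly proper forcing and let $\mathcal{D}=\{D_\alpha\mid\alpha<\kappa^+\}$ be a family of dense open subsets of $\mathbb{P}$. Then there is a $\kappa$-lattice and $\kappa$-strongly proper forcing $\mathbb{P}^*\subseteq\mathbb{P}$ of size $2^\kappa$ and a family of dense subsets of $\mathbb{P}^*$, $\mathcal{D}^*=\{D^*_\alpha\mid\alpha<\kappa^+\}$, such that there is a $\mathcal{D}$-generic filter of $\mathbb{P}$ if and only if there is a $\mathcal{D}^*$-generic filter of $\mathbb{P}^*$.
   Context: The base theory is $\mathsf{ZFC}$; regular cardinals are infinite. In a forcing notion, $q\le p$ means that $q$ extends (is stronger than) $p$. A subset of a forcing notion is regarded as a forcing notion with the inherited order. A set $M$ is $\kappa$-closed if for every $\alpha<\kappa$, every function $f\colon\alpha\to M$ belongs to $M$. A forcing is $\kappa$-lattice if every set of size less than $\kappa$ of pairwise compatible conditions has a greatest lower bound. Let $M$ be a set and $\mathbb{Q}\in M$ a forcing. A condition $q\in\mathbb{Q}$ is strongly $M$-generic (for $\mathbb{Q}$) if for every $q'\le q$ there is $\pi_M(q')\in\mathbb{Q}\cap M$ such that every condition in $\mathbb{Q}\cap M$ extending $\pi_M(q')$ is compatible with $q'$. A forcing $\mathbb{Q}$ is $\kappa$-strongly proper if for every cardinal $\chi$ and every $\kappa$-closed $M$ of size $\kappa$ such that $M\prec H(\chi)$ and $\mathbb{Q}\in M$,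 every $p\in\mathbb{Q}\cap M$ can be extended to a strongly $M$-generic condition. For a family $\mathcal{D}$ of dense subsets of a forcing $\mathbb{Q}$, a $\mathcal{D}$-generic filter of $\mathbb{Q}$ is a filter $G\subseteq\mathbb{Q}$ with $G\cap D\neq\varnothing$ for every $D\in\mathcal{D}$.
   Formalization: "Of size 2^κ" fails when P has fewer than 2^κ conditions (e.g. the one-element forcing); the formal statement says P* has size at most 2^κ, and exactly 2^κ whenever P has at least 2^κ conditions. *)

theory Defs
  imports Main "HOL-Library.Equipollence"
begin

(* HOL alone does not provide a universe of sets, so the base theory ZFC enters as a type class:
   an instance 'v of zfc is a universe of sets, elts x is the extension of the set x, and values
   of type 'v set are classes. Separation and Replacement range over all predicates and functions
   of HOL. The axiom of choice is inherited from Hilbert choice: by Separation, every HOL choice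
   set for a family of nonempty disjoint sets in the universe is itself in the universe. *)
class zfc =
  fixes elts :: "'a \<Rightarrow> 'a set"
  assumes extensionality: "elts x = elts y \<Longrightarrow> x = y"
    and foundation: "wf {(x, y). x \<in> elts y}"
    and pairing: "\<exists>z. elts z = {x, y}"
    and union: "\<exists>z. elts z = (\<Union>y\<in>elts x. elts y)"
    and power_set: "\<exists>z. elts z = {y. elts y \<subseteq> elts x}"
    and separation: "\<exists>z. elts z = {y \<in> elts x. P y}"
    and replacement: "\<exists>z. elts z = f ` elts x"
    and infinity: "\<exists>w. (\<exists>e\<in>elts w. elts e = {}) \<and>
                       (\<forall>x\<in>elts w. \<exists>y\<in>elts w. elts y = insert x (elts x))"

(* Meaningful only for classes that are extensions of sets. *)
definition vset :: "'v::zfc set \<Rightarrow> 'v" where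
  "vset = inv elts"

definition vpair :: "'v::zfc \<Rightarrow> 'v \<Rightarrow> 'v" where
  "vpair x y = vset {vset {x}, vset {x, y}}"

lemma elts_vset_elts: "vset (elts x) = x"
  unfolding vset_def by (intro inv_f_f injI extensionality)

lemma elts_vset_doubleton: "elts (vset {x, y}) = {x, y}"
  by (metis elts_vset_elts pairing)

lemma vpair_inject: "vpair a b = vpair c d \<longleftrightarrow> a = c \<and> b = d"
proof -
  have inj: "vset {x, y} = vset {z, w} \<longleftrightarrow> {x, y} = {z, w}" for x y z w :: 'a
    by (metis elts_vset_doubleton)
  have inj1: "vset {x} = vset {z, w} \<longleftrightarrow> {x} = {z, w}"
    "vset {z, w} = vset {x} \<longleftrightarrow> {z, w} = {x}"
    "vset {x} = vset {z} \<longleftrightarrow> x = z" for x z w :: 'a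
    using inj[of x x z w] inj[of z w x x] inj[of x x z z] by auto
  show ?thesis
    unfolding vpair_def inj by (auto simp: inj inj1 doubleton_eq_iff)
qed

(* f is, as a set of ordered pairs, a function from the set a to the class B. *)
definition vfun :: "'v::zfc \<Rightarrow> 'v \<Rightarrow> 'v set \<Rightarrow> bool" where
  "vfun f a B \<longleftrightarrow> elts f \<subseteq> {vpair x y | x y. x \<in> elts a \<and> y \<in> B} \<and>
                  (\<forall>x\<in>elts a. \<exists>!y. vpair x y \<in> elts f)"

definition transitive :: "'v::zfc \<Rightarrow> bool" where
  "transitive x \<longleftrightarrow> (\<forall>y\<in>elts x. elts y \<subseteq> elts x)"

definition ordinal :: "'v::zfc \<Rightarrow> bool" where
  "ordinal x \<longleftrightarrow> transitive x \<and> (\<forall>y\<in>elts x. transitive y)"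

definition cardinal :: "'v::zfc \<Rightarrow> bool" where
  "cardinal \<kappa> \<longleftrightarrow> ordinal \<kappa> \<and> (\<forall>\<alpha>\<in>elts \<kappa>. \<not> elts \<alpha> \<approx> elts \<kappa>)"

definition regular_cardinal :: "'v::zfc \<Rightarrow> bool" where
  "regular_cardinal \<kappa> \<longleftrightarrow> cardinal \<kappa> \<and> infinite (elts \<kappa>) \<and>
     (\<forall>X \<subseteq> elts \<kappa>. (\<forall>\<alpha>\<in>elts \<kappa>. \<exists>\<beta>\<in>X. \<alpha> = \<beta> \<or> \<alpha> \<in> elts \<beta>) \<longrightarrow> X \<approx> elts \<kappa>)"

definition succ_cardinal :: "'v::zfc \<Rightarrow> 'v" where
  "succ_cardinal \<kappa> = (THE \<mu>. cardinal \<mu> \<and> \<kappa> \<in> elts \<mu> \<and>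
                        (\<forall>\<nu>. cardinal \<nu> \<and> \<kappa> \<in> elts \<nu> \<longrightarrow> elts \<mu> \<subseteq> elts \<nu>))"

(* The cardinal \<kappa>^{<\<kappa>} is the cardinality of this class of functions. *)
definition bounded_seqs :: "'v::zfc \<Rightarrow> 'v set" where
  "bounded_seqs \<kappa> = {f. \<exists>\<alpha>\<in>elts \<kappa>. vfun f \<alpha> (elts \<kappa>)}"

(* The sets whose transitive closure has size less than \<chi>. *)
definition H :: "'v::zfc \<Rightarrow> 'v set" where
  "H \<chi> = {x. {y. (y, x) \<in> {(u, v). u \<in> elts v}\<^sup>+} \<prec> elts \<chi>}"

datatype fm = FMem nat nat | FEq nat nat | FNeg fm | FConj fm fm | FEx nat fm

primrec sat :: "'v::zfc set \<Rightarrow> (nat \<Rightarrow> 'v) \<Rightarrow> fm \<Rightarrow> bool" where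
  "sat A s (FMem i j) \<longleftrightarrow> s i \<in> elts (s j)"
| "sat A s (FEq i j) \<longleftrightarrow> s i = s j"
| "sat A s (FNeg \<phi>) \<longleftrightarrow> \<not> sat A s \<phi>"
| "sat A s (FConj \<phi> \<psi>) \<longleftrightarrow> sat A s \<phi> \<and> sat A s \<psi>"
| "sat A s (FEx i \<phi>) \<longleftrightarrow> (\<exists>a\<in>A. sat A (s(i := a)) \<phi>)"

definition elementary :: "'v::zfc set \<Rightarrow> 'v set \<Rightarrow> bool" where
  "elementary M N \<longleftrightarrow> M \<subseteq> N \<and>
     (\<forall>\<phi> s. range s \<subseteq> M \<longrightarrow> (sat M s \<phi> \<longleftrightarrow> sat N s \<phi>))"

definition closed_under_seqs :: "'v::zfc \<Rightarrow> 'v set \<Rightarrow> bool" where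
  "closed_under_seqs \<kappa> M \<longleftrightarrow> (\<forall>\<alpha>\<in>elts \<kappa>. \<forall>f. vfun f \<alpha> M \<longrightarrow> f \<in> M)"

(* A forcing notion is a set of the form (C, R), where R is a preorder on the nonempty set C.
   le Q q p means that q extends p. *)
definition conds :: "'v::zfc \<Rightarrow> 'v set" where
  "conds Q = {p. \<exists>C R. Q = vpair C R \<and> p \<in> elts C}"

definition le :: "'v::zfc \<Rightarrow> 'v \<Rightarrow> 'v \<Rightarrow> bool" where
  "le Q q p \<longleftrightarrow> (\<exists>C R. Q = vpair C R \<and> vpair q p \<in> elts R)"

definition forcing :: "'v::zfc \<Rightarrow> bool" where
  "forcing Q \<longleftrightarrow>
     (\<exists>C R. Q = vpair C R \<and> elts R \<subseteq> {vpair x y | x y. x \<in> elts C \<and> y \<in> elts C}) \<and>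
     conds Q \<noteq> {} \<and>
     (\<forall>p\<in>conds Q. le Q p p) \<and>
     (\<forall>p q r. le Q p q \<longrightarrow> le Q q r \<longrightarrow> le Q p r)"

definition subforcing :: "'v::zfc \<Rightarrow> 'v \<Rightarrow> bool" where
  "subforcing Q P \<longleftrightarrow> forcing Q \<and> forcing P \<and> conds Q \<subseteq> conds P \<and>
     (\<forall>p\<in>conds Q. \<forall>q\<in>conds Q. le Q q p \<longleftrightarrow> le P q p)"

definition compatible :: "'v::zfc \<Rightarrow> 'v \<Rightarrow> 'v \<Rightarrow> bool" where
  "compatible Q p q \<longleftrightarrow> (\<exists>r\<in>conds Q. le Q r p \<and> le Q r q)"

definition is_glb :: "'v::zfc \<Rightarrow> 'v set \<Rightarrow> 'v \<Rightarrow> bool" where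
  "is_glb Q X g \<longleftrightarrow> g \<in> conds Q \<and> (\<forall>x\<in>X. le Q g x) \<and>
     (\<forall>h\<in>conds Q. (\<forall>x\<in>X. le Q h x) \<longrightarrow> le Q h g)"

definition lattice_forcing :: "'v::zfc \<Rightarrow> 'v \<Rightarrow> bool" where
  "lattice_forcing \<kappa> Q \<longleftrightarrow>
     (\<forall>X \<subseteq> conds Q. X \<prec> elts \<kappa> \<longrightarrow> (\<forall>x\<in>X. \<forall>y\<in>X. compatible Q x y) \<longrightarrow> (\<exists>g. is_glb Q X g))"

definition strongly_generic :: "'v::zfc set \<Rightarrow> 'v \<Rightarrow> 'v \<Rightarrow> bool" where
  "strongly_generic M Q q \<longleftrightarrow> q \<in> conds Q \<and>
     (\<forall>q'\<in>conds Q. le Q q' q \<longrightarrow>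
        (\<exists>\<pi>\<in>conds Q \<inter> M. \<forall>r\<in>conds Q \<inter> M. le Q r \<pi> \<longrightarrow> compatible Q r q'))"

(* A class M with M \<approx> elts \<kappa> is the extension of a set, by Replacement. *)
definition strongly_proper :: "'v::zfc \<Rightarrow> 'v \<Rightarrow> bool" where
  "strongly_proper \<kappa> Q \<longleftrightarrow>
     (\<forall>\<chi> M. cardinal \<chi> \<and> closed_under_seqs \<kappa> M \<and> M \<approx> elts \<kappa> \<and> elementary M (H \<chi>) \<and> Q \<in> M \<longrightarrow>
        (\<forall>p\<in>conds Q \<inter> M. \<exists>q. le Q q p \<and> strongly_generic M Q q))"

definition dense_subset :: "'v::zfc \<Rightarrow> 'v set \<Rightarrow> bool" where
  "dense_subset Q D \<longleftrightarrow> D \<subseteq> conds Q \<and> (\<forall>p\<in>conds Q. \<exists>d\<in>D. le Q d p)"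

definition open_subset :: "'v::zfc \<Rightarrow> 'v set \<Rightarrow> bool" where
  "open_subset Q D \<longleftrightarrow> D \<subseteq> conds Q \<and> (\<forall>d\<in>D. \<forall>q\<in>conds Q. le Q q d \<longrightarrow> q \<in> D)"

definition forcing_filter :: "'v::zfc \<Rightarrow> 'v set \<Rightarrow> bool" where
  "forcing_filter Q G \<longleftrightarrow> G \<subseteq> conds Q \<and> G \<noteq> {} \<and>
     (\<forall>p\<in>G. \<forall>q\<in>conds Q. le Q p q \<longrightarrow> q \<in> G) \<and>
     (\<forall>p\<in>G. \<forall>q\<in>G. \<exists>r\<in>G. le Q r p \<and> le Q r q)"

definition generic_filter :: "'v::zfc \<Rightarrow> 'v set set \<Rightarrow> 'v set \<Rightarrow> bool" where
  "generic_filter Q \<D> G \<longleftrightarrow> forcing_filter Q G \<and> (\<forall>D\<in>\<D>. G \<inter> D \<noteq> {})"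

end

theory Submission
  imports Defs
begin

text \<open>
  If \<open>P\<close> has at most \<open>2\<^sup>\<kappa>\<close> conditions, take \<open>P' = P\<close>. Otherwise let \<open>P'\<close> be the restriction of \<open>P\<close>
  to a set of \<open>2\<^sup>\<kappa>\<close> conditions that is closed under choices of witnesses for facts about at most
  \<open>\<kappa>\<close> conditions: greatest lower bounds, strongly generic extensions, extensions in the dense sets, and
  common extensions inside a fixed generic filter of \<open>P\<close>, if there is one.

  The delicate point is strong properness of \<open>P'\<close>: an elementary submodel \<open>M\<close> of \<open>H(\<chi>)\<close> with
  \<open>P' \<in> M\<close> need not know \<open>P\<close>. By taking Skolem hulls, strong properness of \<open>P\<close> is turned into the
  existence of a function \<open>E\<close> from sequences of length less than \<open>\<kappa>\<close> to conditions such that every set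
  \<open>A\<close> of at most \<open>\<kappa>\<close> conditions closed under \<open>E\<close> has strongly \<open>A\<close>-generic conditions. If \<open>P'\<close>
  is closed under \<open>E\<close>, then the restriction of \<open>E\<close> has size \<open>2\<^sup>\<kappa> = |P'|\<close> and so belongs to \<open>H(\<chi>)\<close>;
  by elementarity \<open>M\<close> contains such a function, and the trace of \<open>M\<close> on \<open>P'\<close> is closed under it.
\<close>

section \<open>Cardinal arithmetic\<close>

lemma lepoll_iff_ordLeq: "A \<lesssim> B \<longleftrightarrow> ordLeq3 (card_of A) (card_of B)"
  by (simp add: card_of_ordLeq lepoll_def)

lemma lepoll_linear: "A \<lesssim> B \<or> B \<lesssim> A"
  unfolding lepoll_iff_ordLeq by (rule ordLeq_total[OF card_of_Well_order card_of_Well_order])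

lemma lesspoll_iff_not_lepoll: "A \<prec> B \<longleftrightarrow> \<not> B \<lesssim> A"
proof
  assume "A \<prec> B"
  then show "\<not> B \<lesssim> A"
    by (auto simp: lesspoll_def dest: lepoll_antisym)
next
  assume "\<not> B \<lesssim> A"
  then show "A \<prec> B"
    using lepoll_linear[of A B] by (auto simp: lesspoll_def dest: eqpoll_sym eqpoll_imp_lepoll)
qed

lemma not_Pow_lepoll: "\<not> Pow A \<lesssim> A"
  by (simp add: lesspoll_Pow_self flip: lesspoll_iff_not_lepoll)

lemma Times_lepoll_infinite:
  assumes "infinite S" "A \<lesssim> S" "B \<lesssim> S"
  shows "A \<times> B \<lesssim> S"
proof -
  have "S \<times> S \<approx> S"
    unfolding eqpoll_iff_card_of_ordIso using assms(1) by (rule card_of_Times_same_infinite)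
  then show ?thesis
    using times_lepoll_mono[OF assms(2,3)] lepoll_trans2 by blast
qed

lemma UN_lepoll_infinite:
  assumes "infinite S" "I \<lesssim> S" "\<And>i. i \<in> I \<Longrightarrow> F i \<lesssim> S"
  shows "(\<Union>i\<in>I. F i) \<lesssim> S"
proof -
  have "(\<Union>i\<in>I. F i) \<subseteq> snd ` Sigma I F"
    by force
  then have "(\<Union>i\<in>I. F i) \<lesssim> Sigma I F"
    by (rule subset_image_lepoll)
  also have "Sigma I F \<lesssim> I \<times> S"
    using assms(3) by (intro Sigma_lepoll_mono) auto
  also have "I \<times> S \<lesssim> S"
    using assms by (intro Times_lepoll_infinite) auto
  finally show ?thesis .
qed

lemma Un_lepoll_infinite:
  assumes "infinite S" "A \<lesssim> S" "B \<lesssim> S"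
  shows "A \<union> B \<lesssim> S"
proof -
  have "(\<Union>b\<in>{True, False}. if b then A else B) \<lesssim> S"
    using assms by (intro UN_lepoll_infinite) (auto intro: finite_lepoll_infinite)
  then show ?thesis by (simp add: Un_commute)
qed

lemma countable_lepoll_infinite: "infinite S \<Longrightarrow> countable A \<Longrightarrow> A \<lesssim> S"
  by (rule lepoll_trans[of A "UNIV :: nat set"])
    (auto simp: countable_def lepoll_def[of A] infinite_le_lepoll)

lemma infinite_lepoll: "A \<lesssim> B \<Longrightarrow> infinite A \<Longrightarrow> infinite B"
  by (auto simp: lepoll_def dest: inj_on_finite)

lemma Pow_lepoll_mono:
  assumes "A \<lesssim> B" shows "Pow A \<lesssim> Pow B"
proof -
  obtain f where f: "inj_on f A" "f ` A \<subseteq> B"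
    using assms unfolding lepoll_def by (elim exE conjE)
  have "inj_on ((`) f) (Pow A)"
    using f(1) by (rule inj_on_image_Pow)
  moreover have "(`) f ` Pow A \<subseteq> Pow B"
    using f(2) by auto
  ultimately show ?thesis
    unfolding lepoll_def by (intro exI conjI)
qed

lemma surj_if_lepoll:
  assumes "B \<lesssim> A" "B \<noteq> {}"
  obtains f where "f ` A = B"
proof -
  obtain g where g: "B \<subseteq> g ` A"
    using assms(1) unfolding lepoll_iff ..
  obtain b where "b \<in> B"
    using assms(2) by blast
  with g have "(\<lambda>x. if g x \<in> B then g x else b) ` A = B"
    by auto
  then show ?thesis ..
qed

text \<open>This is (2^\<kappa>)^\<kappa> = 2^\<kappa>. A nonempty \<open>B\<close> is enumerated by
  \<open>K\<close>, and the codes of its elements under the injection \<open>g\<close> are stored as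
  the sections of one relation on \<open>K\<close>. The empty set has no enumeration by
  \<open>K\<close> and is added by hand.\<close>

lemma bounded_subsets_lepoll:
  assumes K: "infinite K" and Y: "Y \<lesssim> Pow K"
  shows "{B. B \<subseteq> Y \<and> B \<lesssim> K} \<lesssim> Pow K"
proof -
  obtain g where g: "inj_on g Y" "g ` Y \<subseteq> Pow K"
    using Y unfolding lepoll_def by (elim exE conjE)
  let ?dec = "\<lambda>D. {y \<in> Y. \<exists>k\<in>K. g y = D `` {k}}"
  have "{B. B \<subseteq> Y \<and> B \<lesssim> K} \<subseteq> insert {} (?dec ` Pow (K \<times> K))"
  proof
    fix B assume "B \<in> {B. B \<subseteq> Y \<and> B \<lesssim> K}"
    then have B: "B \<subseteq> Y" "B \<lesssim> K" by auto
    show "B \<in> insert {} (?dec ` Pow (K \<times> K))"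
    proof (cases "B = {}")
      case False
      then obtain f where f: "f ` K = B"
        using B surj_if_lepoll by metis
      let ?D = "{(k, m). k \<in> K \<and> m \<in> g (f k)}"
      have D: "?D `` {k} = g (f k)" if "k \<in> K" for k
        using that by auto
      have "?dec ?D = B"
      proof
        show "?dec ?D \<subseteq> B"
        proof
          fix y assume "y \<in> ?dec ?D"
          then obtain k where "y \<in> Y" "k \<in> K" "g y = g (f k)"
            using D by auto
          then show "y \<in> B"
            using g(1) B(1) f by (metis image_eqI inj_onD subsetD)
        qed
        show "B \<subseteq> ?dec ?D"
          using D f B(1) by force
      qed
      moreover have "?D \<in> Pow (K \<times> K)"
        using f B(1) g(2) by fastforce
      ultimately show ?thesis
        by blast
    qed simp
  qed
  then have "{B. B \<subseteq> Y \<and> B \<lesssim> K} \<lesssim> insert {} (?dec ` Pow (K \<times> K))"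
    by (rule subset_imp_lepoll)
  also have "\<dots> \<lesssim> Pow K"
  proof -
    have "?dec ` Pow (K \<times> K) \<lesssim> Pow (K \<times> K)"
      by (rule image_lepoll)
    also have "\<dots> \<lesssim> Pow K"
      using K by (intro Pow_lepoll_mono Times_lepoll_infinite) auto
    finally show ?thesis
      using K Un_lepoll_infinite[of "Pow K" "{{}}"] finite_lepoll_infinite[of "Pow K" "{{}}"]
      by simp
  qed
  finally show ?thesis .
qed

section \<open>Sets, ordinals and cardinals\<close>

text \<open>\<open>vset\<close> inverts \<open>elts\<close> only on such classes, so this is the
  side condition for computing with \<open>vset\<close>.\<close>

definition is_set :: "'v::zfc set \<Rightarrow> bool" where
  "is_set X \<longleftrightarrow> (\<exists>x. elts x = X)"

lemma elts_vset [simp]: "is_set X \<Longrightarrow> elts (vset X) = X"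
  by (metis is_set_def elts_vset_elts)

lemma is_set_elts [simp, intro!]: "is_set (elts x)"
  unfolding is_set_def by blast

lemma is_set_subset:
  assumes "is_set Y" "X \<subseteq> Y"
  shows "is_set X"
proof -
  obtain y where y: "elts y = Y"
    using assms(1) unfolding is_set_def ..
  obtain z where "elts z = {x \<in> elts y. x \<in> X}"
    using separation[of y "\<lambda>x. x \<in> X"] ..
  moreover have "{x \<in> elts y. x \<in> X} = X"
    using y assms(2) by blast
  ultimately show ?thesis
    unfolding is_set_def by auto
qed

lemma is_set_image: "is_set X \<Longrightarrow> is_set (f ` X)" for f :: "'v::zfc \<Rightarrow> 'v"
  using replacement[of f] by (auto simp: is_set_def)

text \<open>Replacement and Separation: a class dominated by a set is covered by an image of that
  set.\<close>

lemma is_set_lepoll: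
  fixes X Y :: "'v::zfc set"
  assumes "X \<lesssim> Y" "is_set Y"
  shows "is_set X"
proof -
  obtain g where "X \<subseteq> g ` Y"
    using assms(1) unfolding lepoll_iff ..
  then show ?thesis
    by (rule is_set_subset[OF is_set_image[OF assms(2)]])
qed

lemma is_set_UN:
  fixes F :: "'v::zfc \<Rightarrow> 'v set"
  assumes "is_set X" "\<And>x. x \<in> X \<Longrightarrow> is_set (F x)"
  shows "is_set (\<Union>x\<in>X. F x)"
proof -
  obtain z where z: "elts z = (\<lambda>x. vset (F x)) ` X"
    using is_set_image[OF assms(1), of "\<lambda>x. vset (F x)"] unfolding is_set_def ..
  obtain u where "elts u = (\<Union>y\<in>elts z. elts y)"
    using union ..
  also have "\<dots> = (\<Union>x\<in>X. F x)"
    using assms(2) by (simp add: z)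
  finally show ?thesis
    unfolding is_set_def ..
qed

lemma is_set_doubleton [simp]: "is_set {x, y}"
  unfolding is_set_def by (rule pairing)

lemma is_set_Un:
  assumes "is_set X" "is_set Y"
  shows "is_set (X \<union> Y)"
proof -
  have "is_set (\<Union>z\<in>{vset X, vset Y}. elts z)"
    by (intro is_set_UN) simp_all
  then show ?thesis
    using assms by simp
qed

lemma is_set_Pow: "is_set (vset ` Pow (elts x))"
proof -
  obtain z where z: "elts z = {y. elts y \<subseteq> elts x}"
    using power_set ..
  have "vset ` Pow (elts x) = {y. elts y \<subseteq> elts x}"
  proof safe
    fix X y assume "X \<subseteq> elts x" "y \<in> elts (vset X)"
    then show "y \<in> elts x"
      using is_set_subset[OF is_set_elts, of X x] by auto
  next
    fix y assume "elts y \<subseteq> elts x"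
    then have "vset (elts y) \<in> vset ` Pow (elts x)"
      by blast
    then show "y \<in> vset ` Pow (elts x)"
      by (simp add: elts_vset_elts)
  qed
  with z show ?thesis
    unfolding is_set_def by auto
qed

lemma inj_on_vset_Pow: "inj_on vset (Pow (elts x))"
  by (rule inj_onI) (metis PowD elts_vset is_set_elts is_set_subset)

lemma mem_not_refl [simp]: "x \<notin> elts x"
  using wf_not_refl[OF foundation, of x] by simp

lemma mem_induct [case_names step]:
  assumes "\<And>x. (\<And>y. y \<in> elts x \<Longrightarrow> P y) \<Longrightarrow> P x"
  shows "P (x::'v::zfc)"
  using foundation by (rule wf_induct_rule) (use assms in auto)

section \<open>Transitive closures and the classes \<open>H \<chi>\<close>\<close>

definition trcl :: "'v::zfc \<Rightarrow> 'v set" where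
  "trcl x = {y. (y, x) \<in> {(u, v). u \<in> elts v}\<^sup>+}"

lemma elts_subset_trcl: "elts x \<subseteq> trcl x"
  by (auto simp: trcl_def)

lemma trcl_trans: "y \<in> trcl x \<Longrightarrow> trcl y \<subseteq> trcl x"
  by (auto simp: trcl_def intro: trancl_trans)

definition trans_class :: "'v::zfc set \<Rightarrow> bool" where
  "trans_class B \<longleftrightarrow> (\<forall>x\<in>B. elts x \<subseteq> B)"

lemma trcl_subset_trans_class:
  assumes "trans_class B" "elts x \<subseteq> B"
  shows "trcl x \<subseteq> B"
proof
  fix y assume "y \<in> trcl x"
  then have "(y, x) \<in> {(u, v). u \<in> elts v}\<^sup>+"
    by (simp add: trcl_def)
  then show "y \<in> B"
    by (induction rule: converse_trancl_induct) (use assms in \<open>auto simp: trans_class_def\<close>)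
qed

lemma trans_class_trcl: "trans_class (trcl x)"
  unfolding trans_class_def by (intro ballI subset_trans[OF elts_subset_trcl trcl_trans])

text \<open>The right-hand side is transitive and includes \<open>elts x\<close>, so it absorbs the
  closure. This recursion makes transitive closures sets by \<in>-induction.\<close>

lemma trcl_unfold: "trcl x = elts x \<union> (\<Union>y\<in>elts x. trcl y)"
proof
  let ?B = "elts x \<union> (\<Union>y\<in>elts x. trcl y)"
  have "trans_class ?B"
    unfolding trans_class_def
  proof
    fix z assume "z \<in> ?B"
    then show "elts z \<subseteq> ?B"
    proof
      assume "z \<in> elts x"
      then show ?thesis
        using elts_subset_trcl[of z] by blast
    next
      assume "z \<in> (\<Union>y\<in>elts x. trcl y)"
      then show ?thesis
        using trans_class_trcl unfolding trans_class_def by (meson UN_E UN_upper le_supI2 subset_trans)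
    qed
  qed
  then show "trcl x \<subseteq> ?B"
    by (rule trcl_subset_trans_class) simp
  show "?B \<subseteq> trcl x"
    using elts_subset_trcl[of x] trcl_trans[of _ x] by blast
qed

lemma is_set_trcl: "is_set (trcl x)"
proof (induction x rule: mem_induct)
  case (step x)
  then show ?case
    by (subst trcl_unfold) (intro is_set_Un is_set_elts is_set_UN)
qed

lemma H_def_trcl: "H \<chi> = {x. trcl x \<prec> elts \<chi>}"
  by (simp add: H_def trcl_def)

lemma trans_class_H: "trans_class (H \<chi>)"
  unfolding trans_class_def
proof (intro ballI subsetI)
  fix x y assume "x \<in> H \<chi>" "y \<in> elts x"
  then have "trcl y \<subseteq> trcl x" "trcl x \<prec> elts \<chi>"
    using elts_subset_trcl[of x] trcl_trans[of y x] by (auto simp: H_def_trcl)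
  then show "y \<in> H \<chi>"
    using lesspoll_trans1[OF subset_imp_lepoll] by (simp add: H_def_trcl)
qed

text \<open>A bound on the transitive closure is enough, so one transitive class \<open>B\<close> of
  size below \<chi> places every set included in it into \<open>H \<chi>\<close>.\<close>

lemma H_I:
  assumes "trans_class B" "B \<prec> elts \<chi>" "elts x \<subseteq> B"
  shows "x \<in> H \<chi>"
  using trcl_subset_trans_class[OF assms(1,3)] assms(2)
  by (auto simp: H_def_trcl intro: lesspoll_trans1 subset_imp_lepoll)

text \<open>One round adds the unordered pairs. Kuratowski pairs need two rounds, and each round
  keeps transitivity and infinite bounds on the size.\<close>

definition with_pairs :: "'v::zfc set \<Rightarrow> 'v set" where
  "with_pairs B = B \<union> (\<lambda>(x, y). vset {x, y}) ` (B \<times> B)"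

lemma trans_class_with_pairs: "trans_class B \<Longrightarrow> trans_class (with_pairs B)"
  by (auto simp: trans_class_def with_pairs_def)

lemma with_pairs_lepoll: "infinite S \<Longrightarrow> B \<lesssim> S \<Longrightarrow> with_pairs B \<lesssim> S"
  unfolding with_pairs_def
  by (intro Un_lepoll_infinite lepoll_trans[OF image_lepoll] Times_lepoll_infinite)

lemma vpair_in_with_pairs: "x \<in> B \<Longrightarrow> y \<in> B \<Longrightarrow> vpair x y \<in> with_pairs (with_pairs B)"
proof -
  assume "x \<in> B" "y \<in> B"
  then have "vset {x} \<in> with_pairs B" "vset {x, y} \<in> with_pairs B"
    unfolding with_pairs_def by (force intro: image_eqI[of _ _ "(x, x)"])+
  then show ?thesis
    unfolding vpair_def with_pairs_def[of "with_pairs B"] by force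
qed

section \<open>Ordinals, Hartogs numbers and successor cardinals\<close>

lemma ordinal_trans: "ordinal \<alpha> \<Longrightarrow> \<beta> \<in> elts \<alpha> \<Longrightarrow> elts \<beta> \<subseteq> elts \<alpha>"
  by (simp add: ordinal_def transitive_def)

lemma ordinal_mem: "ordinal \<alpha> \<Longrightarrow> \<beta> \<in> elts \<alpha> \<Longrightarrow> ordinal \<beta>"
  by (meson ordinal_def subsetD transitive_def)

lemma trans_class_ordinal: "ordinal \<alpha> \<Longrightarrow> trans_class (elts \<alpha>)"
  by (auto simp: trans_class_def dest: ordinal_trans)

text \<open>Double \<in>-induction. If all three alternatives fail, the induction hypotheses give
  both inclusions between the two ordinals, and extensionality yields equality.\<close>

lemma ordinal_linear:
  assumes "ordinal \<alpha>" "ordinal \<beta>"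
  shows "\<alpha> \<in> elts \<beta> \<or> \<alpha> = \<beta> \<or> \<beta> \<in> elts \<alpha>"
  using assms
proof (induction \<alpha> arbitrary: \<beta> rule: mem_induct)
  case (step \<alpha>)
  note IH\<alpha> = step.IH
  from step.prems show ?case
  proof (induction \<beta> rule: mem_induct)
    case (step \<beta>)
    show ?case
    proof (rule ccontr)
      assume *: "\<not> ?case"
      have "elts \<beta> \<subseteq> elts \<alpha>"
        using step.IH step.prems * ordinal_mem ordinal_trans by blast
      moreover have "elts \<alpha> \<subseteq> elts \<beta>"
        using IH\<alpha> step.prems * ordinal_mem ordinal_trans by blast
      ultimately show False
        using * extensionality by blast
    qed
  qed
qed

lemma ordinal_lepollD:
  assumes "ordinal \<alpha>" "ordinal \<beta>" "\<not> elts \<beta> \<lesssim> elts \<alpha>"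
  shows "\<alpha> \<in> elts \<beta>"
  using assms ordinal_linear ordinal_trans subset_imp_lepoll lepoll_refl by metis

text \<open>The ordinal is the image of the Mostowski collapse of a well-order of \<open>Y\<close>.\<close>

lemma eqpoll_ordinal:
  fixes Y :: "'v::zfc set"
  assumes Y: "is_set Y"
  obtains \<beta> :: 'v where "ordinal \<beta>" "elts \<beta> \<approx> Y"
proof -
  obtain r where r: "well_order_on Y r"
    using well_order_on by blast
  define R where "R = r - Id"
  have wf: "wf R" and R_Y: "R \<subseteq> Y \<times> Y"
    using r unfolding R_def well_order_on_def linear_order_on_def partial_order_on_def preorder_on_def
    by auto
  have tr: "trans R"
    using r unfolding R_def well_order_on_def linear_order_on_def partial_order_on_def preorder_on_def
    by (auto intro: trans_diff_Id)
  have tot: "(a, b) \<in> R \<or> a = b \<or> (b, a) \<in> R" if "a \<in> Y" "b \<in> Y" for a b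
    using r that unfolding R_def well_order_on_def linear_order_on_def total_on_def by blast
  have set_below: "is_set {b. (b, a) \<in> R}" for a
    using R_Y by (intro is_set_subset[OF Y]) auto
  define c :: "'v \<Rightarrow> 'v" where "c = wfrec R (\<lambda>f a. vset (f ` {b. (b, a) \<in> R}))"
  have c: "elts (c a) = c ` {b. (b, a) \<in> R}" for a
  proof -
    have "c a = vset (cut c R a ` {b. (b, a) \<in> R})"
      unfolding c_def by (rule wfrec[OF wf])
    also have "cut c R a ` {b. (b, a) \<in> R} = c ` {b. (b, a) \<in> R}"
      by (auto simp: cut_def image_iff)
    finally show ?thesis
      by (simp add: is_set_image[OF set_below])
  qed
  \<comment> \<open>Of two distinct elements of \<open>Y\<close>, one precedes the other, so its
    value is an element of the other value; no set is an element of itself.\<close>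
  have inj: "inj_on c Y"
    by (rule inj_onI) (metis c image_eqI mem_Collect_eq mem_not_refl tot)
  have tr_c: "transitive (c a)" for a
    using tr by (auto simp: transitive_def c dest: transD)
  define \<beta> where "\<beta> = vset (c ` Y)"
  have \<beta>: "elts \<beta> = c ` Y"
    using is_set_image[OF Y] by (simp add: \<beta>_def)
  have "transitive \<beta>"
    using R_Y by (auto simp: transitive_def c \<beta>)
  then have "ordinal \<beta>"
    using tr_c by (auto simp: ordinal_def \<beta>)
  moreover have "elts \<beta> \<approx> Y"
    using inj_on_image_eqpoll_self[OF inj] by (simp add: \<beta>)
  ultimately show ?thesis ..
qed

text \<open>The ordinals that inject into \<open>x\<close> are bounded by an ordinal of the size of
  the power set of \<open>x\<close>, so they form a set \<theta>. A class of size below \<theta> is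
  a set and hence has the size of some ordinal in \<theta>. The last clause thus says that \<theta>
  is the next cardinal after the size of \<open>x\<close>.\<close>

lemma Hartogs:
  fixes x :: "'v::zfc"
  obtains \<theta> :: 'v where "cardinal \<theta>" "elts \<theta> = {\<alpha>. ordinal \<alpha> \<and> elts \<alpha> \<lesssim> elts x}"
    "elts \<theta> \<lesssim> Pow (elts x)" "\<And>Y::'v set. Y \<prec> elts \<theta> \<longleftrightarrow> Y \<lesssim> elts x"
proof -
  obtain \<beta> :: 'v where \<beta>: "ordinal \<beta>" "elts \<beta> \<approx> vset ` Pow (elts x)"
    using is_set_Pow eqpoll_ordinal by metis
  then have \<beta>_Pow: "elts \<beta> \<approx> Pow (elts x)"
    by (meson eqpoll_trans inj_on_image_eqpoll_self inj_on_vset_Pow)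
  let ?A = "{\<alpha>::'v. ordinal \<alpha> \<and> elts \<alpha> \<lesssim> elts x}"
  have sub: "?A \<subseteq> elts \<beta>"
  proof clarify
    fix \<alpha> :: 'v assume "ordinal \<alpha>" and \<alpha>: "elts \<alpha> \<lesssim> elts x"
    have "\<not> elts \<beta> \<lesssim> elts \<alpha>"
      using \<beta>_Pow \<alpha> not_Pow_lepoll by (meson eqpoll_sym lepoll_trans lepoll_trans1)
    then show "\<alpha> \<in> elts \<beta>"
      using \<open>ordinal \<alpha>\<close> \<beta>(1) ordinal_lepollD by blast
  qed
  then obtain \<theta> where \<theta>: "elts \<theta> = ?A"
    using is_set_subset[OF is_set_elts] is_set_def by metis
  have ord: "ordinal \<theta>"
    unfolding ordinal_def transitive_def
  proof (intro conjI ballI)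
    fix \<alpha> assume "\<alpha> \<in> elts \<theta>"
    then have \<alpha>: "ordinal \<alpha>" "elts \<alpha> \<lesssim> elts x" by (auto simp: \<theta>)
    then show "elts \<alpha> \<subseteq> elts \<theta>"
      using ordinal_mem[OF \<alpha>(1)] lepoll_trans[OF subset_imp_lepoll[OF ordinal_trans[OF \<alpha>(1)]] \<alpha>(2)]
      by (auto simp: \<theta>)
    fix y assume "y \<in> elts \<alpha>"
    then show "elts y \<subseteq> elts \<alpha>"
      using \<alpha> ordinal_trans by blast
  qed
  \<comment> \<open>Otherwise \<open>\<theta>\<close> would be one of its own elements.\<close>
  have not_le: "\<not> elts \<theta> \<lesssim> elts x"
    using mem_not_refl[of \<theta>] ord \<theta> by blast
  have card: "cardinal \<theta>"
    unfolding cardinal_def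
    using ord not_le \<theta> by (auto dest: eqpoll_sym intro: lepoll_trans1)
  have less: "Y \<prec> elts \<theta> \<longleftrightarrow> Y \<lesssim> elts x" for Y :: "'v set"
  proof
    assume Y: "Y \<prec> elts \<theta>"
    then have "is_set Y"
      using is_set_lepoll lesspoll_imp_lepoll by blast
    then obtain \<gamma> :: 'v where \<gamma>: "ordinal \<gamma>" "elts \<gamma> \<approx> Y"
      using eqpoll_ordinal by blast
    then have "\<not> elts \<theta> \<lesssim> elts \<gamma>"
      using Y by (meson eq_lesspoll_trans lesspoll_iff_not_lepoll)
    then have "\<gamma> \<in> elts \<theta>"
      using \<gamma>(1) ord ordinal_lepollD by blast
    then show "Y \<lesssim> elts x"
      using \<gamma>(2) \<theta> by (metis (mono_tags, lifting) eqpoll_sym lepoll_trans1 mem_Collect_eq)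
  next
    assume "Y \<lesssim> elts x"
    then show "Y \<prec> elts \<theta>"
      using not_le lesspoll_iff_not_lepoll lepoll_trans by blast
  qed
  have "elts \<theta> \<lesssim> Pow (elts x)"
    using subset_imp_lepoll[OF sub] \<beta>_Pow by (simp add: \<theta> lepoll_trans2)
  then show ?thesis
    using card \<theta> less by (intro that)
qed

lemma cardinal_mem_lesspoll:
  assumes "cardinal \<kappa>" "\<alpha> \<in> elts \<kappa>"
  shows "elts \<alpha> \<prec> elts \<kappa>"
  using assms subset_imp_lepoll[OF ordinal_trans, of \<kappa> \<alpha>]
  by (auto simp: cardinal_def lesspoll_def)

text \<open>The definite description denotes the Hartogs number of \<kappa>, which supplies the
  power set bound and the reading of size below \<kappa>^+ as size at most \<kappa>.\<close>

lemma succ_cardinal: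
  fixes \<kappa> :: "'v::zfc"
  assumes \<kappa>: "cardinal \<kappa>"
  shows "cardinal (succ_cardinal \<kappa>)" "\<kappa> \<in> elts (succ_cardinal \<kappa>)"
    "elts (succ_cardinal \<kappa>) \<lesssim> Pow (elts \<kappa>)"
    "\<And>Y::'v set. Y \<prec> elts (succ_cardinal \<kappa>) \<longleftrightarrow> Y \<lesssim> elts \<kappa>"
proof -
  obtain \<theta> :: 'v where \<theta>: "cardinal \<theta>" "elts \<theta> = {\<alpha>. ordinal \<alpha> \<and> elts \<alpha> \<lesssim> elts \<kappa>}"
    "elts \<theta> \<lesssim> Pow (elts \<kappa>)" "\<And>Y::'v set. Y \<prec> elts \<theta> \<longleftrightarrow> Y \<lesssim> elts \<kappa>"
    using Hartogs by blast
  have mem: "\<kappa> \<in> elts \<theta>"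
    using \<kappa> \<theta>(2) by (simp add: cardinal_def)
  \<comment> \<open>A cardinal above \<open>\<kappa>\<close> does not inject into
    \<open>\<kappa>\<close>, so it is not an element of \<open>\<theta>\<close> and includes
    \<open>\<theta>\<close> by comparability.\<close>
  have least: "elts \<theta> \<subseteq> elts \<nu>" if \<nu>: "cardinal \<nu>" "\<kappa> \<in> elts \<nu>" for \<nu>
  proof -
    have "\<not> elts \<nu> \<lesssim> elts \<kappa>"
      using cardinal_mem_lesspoll[OF \<nu>] by (simp add: lesspoll_iff_not_lepoll)
    then have "\<nu> \<notin> elts \<theta>"
      using \<theta>(2) by simp
    then show ?thesis
      using ordinal_linear[of \<nu> \<theta>] ordinal_trans[of \<nu> \<theta>] \<nu>(1) \<theta>(1)
      by (auto simp: cardinal_def)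
  qed
  have "succ_cardinal \<kappa> = \<theta>"
    unfolding succ_cardinal_def
    using \<theta>(1) mem least by (intro the_equality) (auto intro!: extensionality)
  then show "cardinal (succ_cardinal \<kappa>)" "\<kappa> \<in> elts (succ_cardinal \<kappa>)"
    "elts (succ_cardinal \<kappa>) \<lesssim> Pow (elts \<kappa>)"
    "\<And>Y::'v set. Y \<prec> elts (succ_cardinal \<kappa>) \<longleftrightarrow> Y \<lesssim> elts \<kappa>"
    using \<theta> mem by (auto simp: cardinal_def)
qed

lemma regular_bounded:
  assumes "regular_cardinal \<kappa>" "B \<subseteq> elts \<kappa>" "B \<prec> elts \<kappa>"
  shows "\<exists>j\<in>elts \<kappa>. B \<subseteq> elts j"
proof -
  have ord: "ordinal \<kappa>" and "\<not> B \<approx> elts \<kappa>"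
    using assms by (auto simp: regular_cardinal_def cardinal_def lesspoll_def)
  then obtain \<alpha> where \<alpha>: "\<alpha> \<in> elts \<kappa>" "\<And>\<beta>. \<beta> \<in> B \<Longrightarrow> \<not> (\<alpha> = \<beta> \<or> \<alpha> \<in> elts \<beta>)"
    using assms(1,2) unfolding regular_cardinal_def by meson
  then have "B \<subseteq> elts \<alpha>"
    using ordinal_linear ordinal_mem[OF ord] assms(2) by blast
  with \<alpha>(1) show ?thesis by blast
qed

text \<open>Regularity of \<kappa>^+: an unbounded \<open>B\<close> of size at most \<kappa> would
  cover \<kappa>^+ by at most \<kappa> many sets \<open>insert \<beta> (elts \<beta>)\<close>, each
  of size at most \<kappa>.\<close>

lemma succ_cardinal_bounded:
  assumes "cardinal \<kappa>" "infinite (elts \<kappa>)"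
    and B: "B \<subseteq> elts (succ_cardinal \<kappa>)" "B \<prec> elts (succ_cardinal \<kappa>)"
  shows "\<exists>j\<in>elts (succ_cardinal \<kappa>). B \<subseteq> elts j"
proof (rule ccontr)
  let ?\<theta> = "succ_cardinal \<kappa>"
  note \<theta> = succ_cardinal[OF assms(1)]
  have ord: "ordinal ?\<theta>"
    using \<theta>(1) by (simp add: cardinal_def)
  assume unbounded: "\<not> ?thesis"
  have "elts ?\<theta> \<subseteq> (\<Union>\<beta>\<in>B. insert \<beta> (elts \<beta>))"
  proof
    fix \<alpha> assume \<alpha>: "\<alpha> \<in> elts ?\<theta>"
    then obtain \<beta> where "\<beta> \<in> B" "\<beta> \<notin> elts \<alpha>"
      using unbounded by blast
    then show "\<alpha> \<in> (\<Union>\<beta>\<in>B. insert \<beta> (elts \<beta>))"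
      using ordinal_linear ordinal_mem[OF ord] \<alpha> B(1) by blast
  qed
  then have "elts ?\<theta> \<lesssim> (\<Union>\<beta>\<in>B. insert \<beta> (elts \<beta>))"
    by (rule subset_imp_lepoll)
  also have "\<dots> \<lesssim> elts \<kappa>"
  proof (rule UN_lepoll_infinite[OF assms(2)])
    show "B \<lesssim> elts \<kappa>"
      using B(2) \<theta>(4) by blast
    fix \<beta> assume "\<beta> \<in> B"
    then have "\<beta> \<in> elts ?\<theta>"
      using B(1) by blast
    have "elts \<beta> \<prec> elts ?\<theta>"
      using cardinal_mem_lesspoll \<theta>(1) \<open>\<beta> \<in> elts ?\<theta>\<close> by blast
    then have "elts \<beta> \<lesssim> elts \<kappa>"
      using \<theta>(4) by blast
    then show "insert \<beta> (elts \<beta>) \<lesssim> elts \<kappa>"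
      using Un_lepoll_infinite[OF assms(2), of "{\<beta>}" "elts \<beta>"] finite_lepoll_infinite[OF assms(2), of "{\<beta>}"]
      by simp
  qed
  finally show False
    using \<theta>(4)[of "elts ?\<theta>"] by simp
qed

section \<open>Closure under operations of bounded arity\<close>

text \<open>\<open>\<Phi>\<close> takes a set of fewer than \<open>l\<close> arguments to a set of
  values. With \<kappa> for \<open>l\<close> this gives Skolem hulls, with \<kappa>^+ the conditions
  of the small forcing.\<close>

inductive_set cl :: "'v::zfc \<Rightarrow> ('a set \<Rightarrow> 'a set) \<Rightarrow> 'a set \<Rightarrow> 'a set"
  for l :: "'v::zfc" and \<Phi> :: "'a set \<Rightarrow> 'a set" and X :: "'a set" where
  base: "x \<in> X \<Longrightarrow> x \<in> cl l \<Phi> X"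
| step: "\<forall>b\<in>B. b \<in> cl l \<Phi> X \<Longrightarrow> B \<prec> elts l \<Longrightarrow> x \<in> \<Phi> B \<Longrightarrow> x \<in> cl l \<Phi> X"

text \<open>The stages of \<open>cl\<close>, indexed by the elements of \<open>l\<close>; they make
  the closure countable stage by stage in cardinality arguments.\<close>

inductive cl_level :: "'v::zfc \<Rightarrow> ('a set \<Rightarrow> 'a set) \<Rightarrow> 'a set \<Rightarrow> 'v \<Rightarrow> 'a \<Rightarrow> bool"
  for l :: "'v::zfc" and \<Phi> :: "'a set \<Rightarrow> 'a set" and X :: "'a set" where
  "x \<in> X \<Longrightarrow> cl_level l \<Phi> X j x"
| "\<forall>b\<in>B. \<exists>i\<in>elts j. cl_level l \<Phi> X i b \<Longrightarrow> B \<prec> elts l \<Longrightarrow> x \<in> \<Phi> B \<Longrightarrow> cl_level l \<Phi> X j x"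

text \<open>Each stage has size at most that of \<open>S\<close> by \<in>-induction on its index.
  The stages below \<open>l\<close> exhaust the closure because the stages of fewer than
  \<open>l\<close> arguments are bounded below \<open>l\<close>.\<close>

lemma cl_lepoll:
  fixes l :: "'v::zfc" and \<Phi> :: "'a set \<Rightarrow> 'a set" and S :: "'b set"
  assumes l: "ordinal l" "infinite (elts l)"
    and bounded: "\<And>B. B \<subseteq> elts l \<Longrightarrow> B \<prec> elts l \<Longrightarrow> \<exists>j\<in>elts l. B \<subseteq> elts j"
    and S: "infinite S" "elts l \<lesssim> S"
    and subsets: "\<And>Y :: 'a set. Y \<lesssim> S \<Longrightarrow> {B. B \<subseteq> Y \<and> B \<prec> elts l} \<lesssim> S"
    and \<Phi>: "\<And>B. B \<prec> elts l \<Longrightarrow> \<Phi> B \<lesssim> S"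
    and X: "X \<lesssim> S"
  shows "cl l \<Phi> X \<lesssim> S"
proof -
  let ?L = "\<lambda>j. {x. cl_level l \<Phi> X j x}"
  have level: "?L j \<lesssim> S" if "j \<in> elts l" for j
    using that
  proof (induction j rule: mem_induct)
    case (step j)
    let ?U = "\<Union>i\<in>elts j. ?L i"
    have "elts j \<subseteq> elts l"
      using ordinal_trans[OF l(1) step.prems] .
    then have "?U \<lesssim> S"
      using step.IH by (intro UN_lepoll_infinite[OF S(1)]) (auto intro: lepoll_trans[OF subset_imp_lepoll S(2)])
    then have "{B. B \<subseteq> ?U \<and> B \<prec> elts l} \<lesssim> S"
      by (rule subsets)
    then have "X \<union> (\<Union>B\<in>{B. B \<subseteq> ?U \<and> B \<prec> elts l}. \<Phi> B) \<lesssim> S"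
      using \<Phi> X by (intro Un_lepoll_infinite UN_lepoll_infinite S(1)) auto
    moreover have "?L j \<subseteq> X \<union> (\<Union>B\<in>{B. B \<subseteq> ?U \<and> B \<prec> elts l}. \<Phi> B)"
    proof
      fix x assume "x \<in> ?L j"
      then have "cl_level l \<Phi> X j x" by simp
      then show "x \<in> X \<union> (\<Union>B\<in>{B. B \<subseteq> ?U \<and> B \<prec> elts l}. \<Phi> B)"
        by cases blast+
    qed
    ultimately show ?case
      by (meson lepoll_trans subset_imp_lepoll)
  qed
  have "cl l \<Phi> X \<subseteq> (\<Union>j\<in>elts l. ?L j)"
  proof
    fix x assume "x \<in> cl l \<Phi> X"
    then show "x \<in> (\<Union>j\<in>elts l. ?L j)"
    proof (induction rule: cl.induct)
      case (base x)
      moreover obtain j where "j \<in> elts l"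
        using l(2) by (metis finite.emptyI ex_in_conv)
      moreover have "cl_level l \<Phi> X j x"
        using \<open>x \<in> X\<close> by (rule cl_level.intros(1))
      ultimately show ?case
        by blast
    next
      case (step B x)
      then have "\<forall>b\<in>B. \<exists>i. i \<in> elts l \<and> cl_level l \<Phi> X i b"
        by blast
      from bchoice[OF this] obtain i
        where i: "\<forall>b\<in>B. i b \<in> elts l \<and> cl_level l \<Phi> X (i b) b" ..
      have "i ` B \<prec> elts l"
        using image_lepoll step.hyps(1) lesspoll_trans1 by blast
      then obtain j where j: "j \<in> elts l" "i ` B \<subseteq> elts j"
        using bounded[of "i ` B"] i by blast
      have "cl_level l \<Phi> X j x"
        using i j(2) step.hyps by (intro cl_level.intros(2)[of B]) auto
      then show ?case
        using j(1) by blast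
    qed
  qed
  then have "cl l \<Phi> X \<lesssim> (\<Union>j\<in>elts l. ?L j)"
    by (rule subset_imp_lepoll)
  also have "\<dots> \<lesssim> S"
    using level S by (intro UN_lepoll_infinite) auto
  finally show ?thesis .
qed

lemma cl_mono:
  assumes "X \<subseteq> Y"
  shows "cl l \<Phi> X \<subseteq> cl l \<Phi> Y"
proof
  fix x assume "x \<in> cl l \<Phi> X"
  then show "x \<in> cl l \<Phi> Y"
    by induction (use assms in \<open>auto intro: cl.intros\<close>)
qed

lemma cl_closed: "B \<subseteq> cl l \<Phi> X \<Longrightarrow> B \<prec> elts l \<Longrightarrow> \<Phi> B \<subseteq> cl l \<Phi> X"
  by (blast intro: cl.step)

lemma cl_subset:
  assumes "X \<subseteq> N" "\<And>B. B \<subseteq> N \<Longrightarrow> B \<prec> elts l \<Longrightarrow> \<Phi> B \<subseteq> N"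
  shows "cl l \<Phi> X \<subseteq> N"
proof
  fix x assume "x \<in> cl l \<Phi> X"
  then show "x \<in> N"
    by induction (use assms in blast)+
qed

section \<open>Sequences of length less than \<open>\<kappa>\<close>\<close>

definition mkfun :: "'v::zfc \<Rightarrow> ('v \<Rightarrow> 'v) \<Rightarrow> 'v" where
  "mkfun \<alpha> g = vset ((\<lambda>x. vpair x (g x)) ` elts \<alpha>)"

definition vran :: "'v::zfc \<Rightarrow> 'v set" where
  "vran f = {y. \<exists>x. vpair x y \<in> elts f}"

definition seqs :: "'v::zfc \<Rightarrow> 'v set \<Rightarrow> 'v set" where
  "seqs \<kappa> B = {f. \<exists>\<alpha>\<in>elts \<kappa>. vfun f \<alpha> B}"

lemma elts_mkfun [simp]: "elts (mkfun \<alpha> g) = (\<lambda>x. vpair x (g x)) ` elts \<alpha>"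
  by (simp add: mkfun_def is_set_image)

lemma vpair_mem_mkfun: "vpair x y \<in> elts (mkfun \<alpha> g) \<longleftrightarrow> x \<in> elts \<alpha> \<and> y = g x"
  by (auto simp: vpair_inject)

lemma vran_mkfun [simp]: "vran (mkfun \<alpha> g) = g ` elts \<alpha>"
  by (auto simp: vran_def vpair_inject)

lemma mkfun_eq_iff: "mkfun \<alpha> g = mkfun \<beta> h \<longleftrightarrow> \<alpha> = \<beta> \<and> (\<forall>x\<in>elts \<alpha>. g x = h x)"
proof
  assume eq: "mkfun \<alpha> g = mkfun \<beta> h"
  have "(x \<in> elts \<alpha> \<and> y = g x) = (x \<in> elts \<beta> \<and> y = h x)" for x y
    using eq by (metis vpair_mem_mkfun)
  then show "\<alpha> = \<beta> \<and> (\<forall>x\<in>elts \<alpha>. g x = h x)"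
    by (intro conjI extensionality) blast+
next
  assume "\<alpha> = \<beta> \<and> (\<forall>x\<in>elts \<alpha>. g x = h x)"
  then show "mkfun \<alpha> g = mkfun \<beta> h"
    by (simp add: mkfun_def)
qed

text \<open>This lets sequences be handled as HOL functions restricted to an ordinal;
  \<open>g\<close> is read off from \<open>f\<close> by definite description.\<close>

lemma vfun_iff_mkfun: "vfun f \<alpha> B \<longleftrightarrow> (\<exists>g. g ` elts \<alpha> \<subseteq> B \<and> f = mkfun \<alpha> g)"
proof
  assume f: "vfun f \<alpha> B"
  define g where "g x = (THE y. vpair x y \<in> elts f)" for x
  have g: "vpair x y \<in> elts f \<longleftrightarrow> y = g x" if "x \<in> elts \<alpha>" for x y
  proof -
    have ex1: "\<exists>!y. vpair x y \<in> elts f"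
      using f that by (simp add: vfun_def)
    from theI'[OF this] show ?thesis
      unfolding g_def using ex1 by blast
  qed
  have sub: "elts f \<subseteq> {vpair x y | x y. x \<in> elts \<alpha> \<and> y \<in> B}"
    using f by (simp add: vfun_def)
  have "elts f = elts (mkfun \<alpha> g)"
    unfolding elts_mkfun
  proof (intro set_eqI iffI)
    fix z assume "z \<in> elts f"
    moreover from this obtain x y where "z = vpair x y" "x \<in> elts \<alpha>"
      using sub by blast
    ultimately show "z \<in> (\<lambda>x. vpair x (g x)) ` elts \<alpha>"
      using g by simp
  next
    fix z assume "z \<in> (\<lambda>x. vpair x (g x)) ` elts \<alpha>"
    then show "z \<in> elts f"
      using g by auto
  qed
  moreover have "g ` elts \<alpha> \<subseteq> B"
  proof clarify
    fix x assume x: "x \<in> elts \<alpha>"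
    then have "vpair x (g x) \<in> elts f"
      using g by simp
    then show "g x \<in> B"
      using sub by (auto simp: vpair_inject)
  qed
  ultimately show "\<exists>g. g ` elts \<alpha> \<subseteq> B \<and> f = mkfun \<alpha> g"
    using extensionality by blast
next
  assume "\<exists>g. g ` elts \<alpha> \<subseteq> B \<and> f = mkfun \<alpha> g"
  then show "vfun f \<alpha> B"
    by (auto simp: vfun_def vpair_inject image_iff image_subset_iff)
qed

lemma seqsE:
  assumes "f \<in> seqs \<kappa> B"
  obtains \<alpha> g where "\<alpha> \<in> elts \<kappa>" "g ` elts \<alpha> \<subseteq> B" "f = mkfun \<alpha> g"
  using assms unfolding seqs_def vfun_iff_mkfun by blast

lemma seqsI: "\<alpha> \<in> elts \<kappa> \<Longrightarrow> g ` elts \<alpha> \<subseteq> B \<Longrightarrow> mkfun \<alpha> g \<in> seqs \<kappa> B"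
  unfolding seqs_def vfun_iff_mkfun by blast

lemma bounded_seqs_eq: "bounded_seqs \<kappa> = seqs \<kappa> (elts \<kappa>)"
  by (simp add: bounded_seqs_def seqs_def)

lemma seqs_mono: "A \<subseteq> B \<Longrightarrow> seqs \<kappa> A \<subseteq> seqs \<kappa> B"
  by (fastforce elim: seqsE intro: seqsI)

lemma closed_under_seqs_iff: "closed_under_seqs \<kappa> M \<longleftrightarrow> seqs \<kappa> M \<subseteq> M"
  by (auto simp: closed_under_seqs_def seqs_def)

locale regular_exp =
  fixes \<kappa> :: "'v::zfc"
  assumes regular: "regular_cardinal \<kappa>"
    and exp: "bounded_seqs \<kappa> \<approx> elts \<kappa>"
begin

abbreviation K :: "'v set" where "K \<equiv> elts \<kappa>"

lemma card: "cardinal \<kappa>" and inf: "infinite K"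
  using regular by (auto simp: regular_cardinal_def)

lemma ord: "ordinal \<kappa>"
  using card by (simp add: cardinal_def)

lemma ord_mem: "\<alpha> \<in> K \<Longrightarrow> ordinal \<alpha>"
  using ord ordinal_mem by blast

lemma mem_lesspoll: "\<alpha> \<in> K \<Longrightarrow> elts \<alpha> \<prec> K"
  using card cardinal_mem_lesspoll by blast

lemma finite_lesspoll: "finite B \<Longrightarrow> B \<prec> K"
  using inf finite_lesspoll_infinite by blast

lemma bounded: "B \<subseteq> K \<Longrightarrow> B \<prec> K \<Longrightarrow> \<exists>j\<in>K. B \<subseteq> elts j"
  using regular regular_bounded by blast

lemma lesspoll_bounded:
  assumes "B \<prec> K"
  shows "\<exists>j\<in>K. B \<lesssim> elts j"
proof -
  obtain h where h: "inj_on h B" "h ` B \<subseteq> K"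
    using lesspoll_imp_lepoll[OF assms] unfolding lepoll_def by blast
  then obtain j where "j \<in> K" "h ` B \<subseteq> elts j"
    using bounded[of "h ` B"] assms by auto
  with h(1) show ?thesis
    unfolding lepoll_def by blast
qed

text \<open>By regularity a single ordinal \<open>j\<close> below \<kappa> bounds the sizes of all
  \<open>F i\<close>. The larger of \<open>j\<close> and a bound for \<open>I\<close> then bounds
  the union if it is infinite; the finite case is separate since \<kappa> may be \<omega>.\<close>

lemma small_UN:
  assumes "I \<prec> K" "\<And>i. i \<in> I \<Longrightarrow> F i \<prec> K"
  shows "(\<Union>i\<in>I. F i) \<prec> K"
proof -
  obtain a where a: "\<And>i. i \<in> I \<Longrightarrow> a i \<in> K \<and> F i \<lesssim> elts (a i)"
    using lesspoll_bounded[OF assms(2)] by metis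
  have "a ` I \<prec> K"
    using image_lepoll assms(1) by (rule lesspoll_trans1)
  then obtain j where j: "j \<in> K" "a ` I \<subseteq> elts j"
    using bounded[of "a ` I"] a by blast
  have Fj: "F i \<lesssim> elts j" if "i \<in> I" for i
  proof -
    have "elts (a i) \<subseteq> elts j"
      using ordinal_trans[OF ord_mem[OF j(1)]] j(2) that by blast
    then show ?thesis
      using a[OF that] by (meson lepoll_trans subset_imp_lepoll)
  qed
  obtain k where k: "k \<in> K" "I \<lesssim> elts k"
    using lesspoll_bounded[OF assms(1)] by blast
  show ?thesis
  proof (cases "finite I \<and> finite (elts j)")
    case True
    then have "finite (\<Union>i\<in>I. F i)"
      using Fj by (auto simp: lepoll_def dest: inj_on_finite)
    then show ?thesis
      by (rule finite_lesspoll)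
  next
    case False
    obtain m where m: "m \<in> K" "elts j \<subseteq> elts m" "elts k \<subseteq> elts m"
    proof -
      from ordinal_linear[OF ord_mem[OF j(1)] ord_mem[OF k(1)]] show ?thesis
        using that[of j] that[of k] j k ordinal_trans ord_mem by blast
    qed
    have "infinite (elts m)"
      using False m k(2) by (metis finite_subset lepoll_def inj_on_finite)
    then have "(\<Union>i\<in>I. F i) \<lesssim> elts m"
      using lepoll_trans[OF Fj subset_imp_lepoll[OF m(2)]] lepoll_trans[OF k(2) subset_imp_lepoll[OF m(3)]]
      by (intro UN_lepoll_infinite)
    then show ?thesis
      using mem_lesspoll[OF m(1)] lesspoll_trans1 by blast
  qed
qed

lemma seqs_lepoll:
  assumes "Y \<lesssim> K"
  shows "seqs \<kappa> Y \<lesssim> K"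
proof -
  obtain h where h: "inj_on h Y" "h ` Y \<subseteq> K"
    using assms unfolding lepoll_def by blast
  have "seqs \<kappa> Y \<lesssim> seqs \<kappa> K"
  \<comment> \<open>Sequences are composed with \<open>h\<close>. A relation is used since a
    sequence determines \<open>g\<close> only on its domain.\<close>
  proof (rule lepoll_relational_full[where
      R = "\<lambda>f' f. \<exists>\<alpha> g. g ` elts \<alpha> \<subseteq> Y \<and> f = mkfun \<alpha> g \<and> f' = mkfun \<alpha> (h \<circ> g)"])
    fix f assume "f \<in> seqs \<kappa> Y"
    then obtain \<alpha> g where f: "\<alpha> \<in> K" "g ` elts \<alpha> \<subseteq> Y" "f = mkfun \<alpha> g"
      by (rule seqsE)
    then have "mkfun \<alpha> (h \<circ> g) \<in> seqs \<kappa> K"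
      using h(2) by (intro seqsI) auto
    then show "\<exists>f'. f' \<in> seqs \<kappa> K \<and> (\<exists>\<alpha> g. g ` elts \<alpha> \<subseteq> Y \<and> f = mkfun \<alpha> g \<and> f' = mkfun \<alpha> (h \<circ> g))"
      using f by blast
  next
    fix f' f1 f2
    assume "\<exists>\<alpha> g. g ` elts \<alpha> \<subseteq> Y \<and> f1 = mkfun \<alpha> g \<and> f' = mkfun \<alpha> (h \<circ> g)"
      and "\<exists>\<alpha> g. g ` elts \<alpha> \<subseteq> Y \<and> f2 = mkfun \<alpha> g \<and> f' = mkfun \<alpha> (h \<circ> g)"
    then show "f1 = f2"
      using inj_onD[OF h(1)] by (auto simp: mkfun_eq_iff image_subset_iff)
  qed
  also have "seqs \<kappa> K \<approx> K"
    using exp by (simp add: bounded_seqs_eq)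
  finally show ?thesis .
qed

text \<open>The lengths of possible enumerations are cofinal in \<open>\<kappa>\<close>, hence \<open>\<kappa>\<close> many by regularity.\<close>

lemma many_enumerations:
  assumes "B \<prec> K" "B \<noteq> {}"
  shows "K \<lesssim> {f \<in> seqs \<kappa> B. vran f = B}"
proof -
  obtain j where j: "j \<in> K" "B \<lesssim> elts j"
    using lesspoll_bounded[OF assms(1)] by blast
  let ?T = "{\<gamma> \<in> K. elts j \<subseteq> elts \<gamma>}"
  have "\<exists>\<beta>\<in>?T. \<alpha> = \<beta> \<or> \<alpha> \<in> elts \<beta>" if "\<alpha> \<in> K" for \<alpha>
    using ordinal_linear[of \<alpha> j] ordinal_trans[of \<alpha> j] ord_mem that j(1) by blast
  then have "?T \<approx> K"
    using regular unfolding regular_cardinal_def by (metis (no_types, lifting) mem_Collect_eq subsetI)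
  then have "K \<lesssim> ?T"
    by (simp add: eqpoll_imp_lepoll eqpoll_sym)
  also have "?T \<lesssim> {f \<in> seqs \<kappa> B. vran f = B}"
  proof -
    have "\<exists>g. g ` elts \<gamma> = B" if "\<gamma> \<in> ?T" for \<gamma>
    proof -
      have "B \<lesssim> elts \<gamma>"
        using that j(2) by (auto intro: lepoll_trans subset_imp_lepoll)
      then show ?thesis
        using assms(2) surj_if_lepoll by metis
    qed
    then obtain g where g: "\<And>\<gamma>. \<gamma> \<in> ?T \<Longrightarrow> g \<gamma> ` elts \<gamma> = B"
      by metis
    show ?thesis
      unfolding lepoll_def
    proof (intro exI conjI)
      show "inj_on (\<lambda>\<gamma>. mkfun \<gamma> (g \<gamma>)) ?T"
        by (auto simp: inj_on_def mkfun_eq_iff)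
      show "(\<lambda>\<gamma>. mkfun \<gamma> (g \<gamma>)) ` ?T \<subseteq> {f \<in> seqs \<kappa> B. vran f = B}"
        using g by (auto intro!: seqsI)
    qed
  qed
  finally show ?thesis .
qed

text \<open>Every nonempty small subset of \<open>Y\<close> is the range of a short sequence in
  \<open>Y\<close>, and there are at most \<kappa> of these by \<kappa>^{<\<kappa>} =
  \<kappa>.\<close>

lemma small_subsets_lepoll:
  fixes Y :: "'v set"
  assumes "Y \<lesssim> K"
  shows "{B. B \<subseteq> Y \<and> B \<prec> K} \<lesssim> K"
proof -
  have "{B. B \<subseteq> Y \<and> B \<prec> K} \<subseteq> {{}} \<union> vran ` seqs \<kappa> Y"
  proof
    fix B assume "B \<in> {B. B \<subseteq> Y \<and> B \<prec> K}"
    then have B: "B \<subseteq> Y" "B \<prec> K" by auto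
    show "B \<in> {{}} \<union> vran ` seqs \<kappa> Y"
    proof (cases "B = {}")
      case False
      then have "{f \<in> seqs \<kappa> B. vran f = B} \<noteq> {}"
        using many_enumerations[OF B(2)] inf by (metis finite.emptyI lepoll_empty_iff_empty)
      then show ?thesis
        using seqs_mono[OF B(1)] by blast
    qed simp
  qed
  then have "{B. B \<subseteq> Y \<and> B \<prec> K} \<lesssim> {{}} \<union> vran ` seqs \<kappa> Y"
    by (rule subset_imp_lepoll)
  also have "\<dots> \<lesssim> K"
    using assms seqs_lepoll inf
    by (intro Un_lepoll_infinite) (auto intro: finite_lepoll_infinite lepoll_trans[OF image_lepoll])
  finally show ?thesis .
qed

text \<open>A derivation has fewer than \<kappa> premises at each step, so by regularity it uses
  fewer than \<kappa> elements of \<open>A\<close> in all. The fixed part \<open>X\<close> is not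
  counted.\<close>

lemma cl_support:
  assumes "x \<in> cl \<kappa> \<Phi> (X \<union> A)"
  shows "\<exists>a \<subseteq> A. a \<prec> K \<and> x \<in> cl \<kappa> \<Phi> (X \<union> a)"
  using assms
proof induction
  case (base x)
  show ?case
  proof (cases "x \<in> A")
    case True
    then show ?thesis
      by (intro exI[of _ "{x}"]) (auto intro: finite_lesspoll cl.base)
  next
    case False
    then show ?thesis
      using base by (intro exI[of _ "{}"]) (auto intro: finite_lesspoll cl.base)
  qed
next
  case (step B x)
  then obtain a where a: "\<And>b. b \<in> B \<Longrightarrow> a b \<subseteq> A \<and> a b \<prec> K \<and> b \<in> cl \<kappa> \<Phi> (X \<union> a b)"
    by metis
  have "(\<Union>b\<in>B. a b) \<prec> K"
    using a step.hyps(1) by (intro small_UN) auto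
  moreover have "x \<in> cl \<kappa> \<Phi> (X \<union> (\<Union>b\<in>B. a b))"
    using step.hyps a cl_mono[of "X \<union> a _" "X \<union> (\<Union>b\<in>B. a b)"]
    by (intro cl.step[of B]) blast+
  ultimately show ?case
    using a by (intro exI[of _ "\<Union>b\<in>B. a b"]) blast
qed

end

section \<open>Elementary submodels\<close>

text \<open>A strict bound on all variables, free or bound. Satisfaction depends only on values
  below it, so an assignment can be cut down to a finite list.\<close>

primrec vbound :: "fm \<Rightarrow> nat" where
  "vbound (FMem i j) = Suc (max i j)"
| "vbound (FEq i j) = Suc (max i j)"
| "vbound (FNeg \<phi>) = vbound \<phi>"
| "vbound (FConj \<phi> \<psi>) = max (vbound \<phi>) (vbound \<psi>)"
| "vbound (FEx i \<phi>) = max (Suc i) (vbound \<phi>)"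

lemma sat_cong: "(\<And>n. n < vbound \<phi> \<Longrightarrow> s n = t n) \<Longrightarrow> sat A s \<phi> \<longleftrightarrow> sat A t \<phi>"
proof (induction \<phi> arbitrary: s t)
  case (FEx i \<phi>)
  have "sat A (s(i := a)) \<phi> \<longleftrightarrow> sat A (t(i := a)) \<phi>" for a
  proof (rule FEx.IH)
    fix n assume "n < vbound \<phi>"
    then show "(s(i := a)) n = (t(i := a)) n"
      using FEx.prems[of n] by simp
  qed
  then show ?case by simp
next
  case (FNeg \<phi>)
  have "sat A s \<phi> \<longleftrightarrow> sat A t \<phi>"
    by (rule FNeg.IH, rule FNeg.prems, simp)
  then show ?case by simp
next
  case (FConj \<phi> \<psi>)
  have "sat A s \<phi> \<longleftrightarrow> sat A t \<phi>" "sat A s \<psi> \<longleftrightarrow> sat A t \<psi>"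
    by (rule FConj.IH, rule FConj.prems, simp)+
  then show ?case by simp
qed simp_all

definition asg :: "'v \<Rightarrow> 'v list \<Rightarrow> nat \<Rightarrow> 'v" where
  "asg d xs n = (if n < length xs then xs ! n else d)"

text \<open>The parameters form a finite list, padded by \<open>d\<close>. The value is
  \<open>d\<close> also where no witness exists, so it lies in \<open>N\<close> whenever
  \<open>d\<close> does.\<close>

definition skolem :: "'v::zfc set \<Rightarrow> 'v \<Rightarrow> fm \<Rightarrow> nat \<Rightarrow> 'v list \<Rightarrow> 'v" where
  "skolem N d \<phi> i xs =
    (if \<exists>a\<in>N. sat N ((asg d xs)(i := a)) \<phi> then SOME a. a \<in> N \<and> sat N ((asg d xs)(i := a)) \<phi> else d)"

lemma sat_skolem:
  assumes ex: "\<exists>a\<in>N. sat N ((asg d xs)(i := a)) \<phi>"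
  shows "skolem N d \<phi> i xs \<in> N" "sat N ((asg d xs)(i := skolem N d \<phi> i xs)) \<phi>"
proof -
  have "skolem N d \<phi> i xs = (SOME a. a \<in> N \<and> sat N ((asg d xs)(i := a)) \<phi>)"
    using ex by (simp only: skolem_def if_True)
  moreover have "\<exists>a. a \<in> N \<and> sat N ((asg d xs)(i := a)) \<phi>"
    using ex by blast
  from someI_ex[OF this] have "(SOME a. a \<in> N \<and> sat N ((asg d xs)(i := a)) \<phi>) \<in> N"
    "sat N ((asg d xs)(i := (SOME a. a \<in> N \<and> sat N ((asg d xs)(i := a)) \<phi>))) \<phi>"
    by (rule conjunct1, rule conjunct2)
  ultimately show "skolem N d \<phi> i xs \<in> N" "sat N ((asg d xs)(i := skolem N d \<phi> i xs)) \<phi>"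
    by (simp_all only:)
qed

lemma skolem_in: "d \<in> N \<Longrightarrow> skolem N d \<phi> i xs \<in> N"
  using sat_skolem(1)[of N d xs i \<phi>] by (auto simp: skolem_def)

text \<open>The Tarski-Vaught test, with witnesses supplied by the Skolem functions of
  \<open>N\<close>.\<close>

lemma elementary_if_skolem_closed:
  assumes MN: "M \<subseteq> N" and d: "d \<in> M"
    and closed: "\<And>\<phi> i xs. set xs \<subseteq> M \<Longrightarrow> skolem N d \<phi> i xs \<in> M"
  shows "elementary M N"
proof -
  have "sat M s \<phi> \<longleftrightarrow> sat N s \<phi>" if "range s \<subseteq> M" for s \<phi>
    using that
  proof (induction \<phi> arbitrary: s)
    case (FEx i \<phi>)
    have upd: "range (s(i := a)) \<subseteq> M" if "a \<in> M" for a
      using FEx.prems that by auto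
    show ?case
    proof
      assume "sat M s (FEx i \<phi>)"
      then obtain a where "a \<in> M" "sat M (s(i := a)) \<phi>"
        by auto
      then have "a \<in> N" "sat N (s(i := a)) \<phi>"
        using FEx.IH[OF upd] MN by blast+
      then show "sat N s (FEx i \<phi>)"
        unfolding sat.simps by blast
    next
      assume "sat N s (FEx i \<phi>)"
      then obtain a where a: "a \<in> N" "sat N (s(i := a)) \<phi>"
        by auto
      \<comment> \<open>The values of the first \<open>vbound \<phi>\<close> variables; changing the
        others to \<open>d\<close> does not affect \<open>\<phi>\<close>.\<close>
      define xs where "xs = map s [0..<vbound \<phi>]"
      have xs: "set xs \<subseteq> M"
        using FEx.prems by (auto simp: xs_def)
      have agree: "sat N ((asg d xs)(i := b)) \<phi> \<longleftrightarrow> sat N (s(i := b)) \<phi>" for b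
        by (rule sat_cong) (auto simp: asg_def xs_def)
      have "sat N (s(i := skolem N d \<phi> i xs)) \<phi>"
        using sat_skolem(2)[of N d xs i \<phi>] a agree by blast
      then show "sat M s (FEx i \<phi>)"
        unfolding sat.simps using FEx.IH[OF upd] closed[OF xs] by blast
    qed
  qed (auto simp: MN)
  then show ?thesis
    using MN by (simp add: elementary_def)
qed

text \<open>Elementarity is applied below in this form: satisfaction is evaluated in
  \<open>N\<close> on both sides, so \<open>M\<close>, which need not be transitive, enters only as
  the home of parameters and witness.\<close>

lemma elementary_witness:
  assumes el: "elementary M N" and s: "\<And>n. s n \<in> M" and a: "a \<in> N" "sat N (s(i := a)) \<phi>"
  obtains b where "b \<in> M" "sat N (s(i := b)) \<phi>"
proof -
  have iff: "sat M t \<psi> \<longleftrightarrow> sat N t \<psi>" if "\<And>n. t n \<in> M" for t \<psi>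
    using el that unfolding elementary_def by (simp add: image_subset_iff)
  have "sat N s (FEx i \<phi>)"
    using a by auto
  then have "sat M s (FEx i \<phi>)"
    using iff[of s] s by blast
  then obtain b where b: "b \<in> M" "sat M (s(i := b)) \<phi>"
    by auto
  moreover have "(s(i := b)) n \<in> M" for n
    using s b(1) by simp
  ultimately show ?thesis
    using that[OF b(1)] iff[of "s(i := b)"] by blast
qed

section \<open>Strong properness as closure of sets of conditions under one function\<close>

instance fm :: countable
  by countable_datatype

lemma conds_vpair [simp]: "conds (vpair C R) = elts C"
  by (auto simp: conds_def vpair_inject)

lemma le_vpair [simp]: "le (vpair C R) q p \<longleftrightarrow> vpair q p \<in> elts R"
  by (auto simp: le_def vpair_inject)

text \<open>A submodel enters strong genericity only through its trace on the conditions, so a set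
  of conditions can take its place.\<close>

lemma strongly_generic_Int:
  "conds P \<inter> M = A \<Longrightarrow> strongly_generic M P q \<longleftrightarrow> strongly_generic A P q"
  by (auto simp: strongly_generic_def)

text \<open>The conclusion of strong properness, with the submodel replaced by a set of
  conditions.\<close>

definition good_set :: "'v::zfc \<Rightarrow> 'v set \<Rightarrow> bool" where
  "good_set P A \<longleftrightarrow> (\<forall>p\<in>A. \<exists>q. le P q p \<and> strongly_generic A P q)"

context regular_exp
begin

text \<open>By the hypotheses \<theta> is the next cardinal after the size of \<open>u\<close>,
  which is at least \<kappa>; so the transitive closures of fewer than \<kappa> elements of
  \<open>H \<theta>\<close> have a union of size at most that of \<open>u\<close>.\<close>

lemma mkfun_in_H:
  assumes \<theta>: "\<And>Y :: 'v set. Y \<prec> elts \<theta> \<longleftrightarrow> Y \<lesssim> elts u" and u: "K \<lesssim> elts u"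
    and \<alpha>: "\<alpha> \<in> K" and g: "g ` elts \<alpha> \<subseteq> H \<theta>"
  shows "mkfun \<alpha> g \<in> H \<theta>"
proof -
  have inf_u: "infinite (elts u)"
    using infinite_lepoll[OF u inf] .
  \<comment> \<open>\<open>trcl (g x)\<close> omits \<open>g x\<close> itself, hence the insertion.
    Two rounds of pairing then accommodate the graph.\<close>
  let ?T = "elts \<alpha> \<union> (\<Union>x\<in>elts \<alpha>. insert (g x) (trcl (g x)))"
  have "trans_class ?T"
    unfolding trans_class_def
  proof
    fix z assume "z \<in> ?T"
    then consider "z \<in> elts \<alpha>" | x where "x \<in> elts \<alpha>" "z = g x" | x where "x \<in> elts \<alpha>" "z \<in> trcl (g x)"
      by blast
    then show "elts z \<subseteq> ?T"
    proof cases
      case 1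
      then show ?thesis
        using ordinal_trans[OF ord_mem[OF \<alpha>]] by blast
    next
      case 2
      then show ?thesis
        using elts_subset_trcl by blast
    next
      case 3
      then have "elts z \<subseteq> trcl (g x)"
        using trans_class_trcl unfolding trans_class_def by blast
      with 3 show ?thesis by blast
    qed
  qed
  then have tr: "trans_class (with_pairs (with_pairs ?T))"
    by (intro trans_class_with_pairs)
  have \<alpha>u: "elts \<alpha> \<lesssim> elts u"
    using lepoll_trans[OF lesspoll_imp_lepoll[OF mem_lesspoll[OF \<alpha>]] u] .
  have "insert (g x) (trcl (g x)) \<lesssim> elts u" if "x \<in> elts \<alpha>" for x
  proof -
    have "trcl (g x) \<lesssim> elts u"
      using subsetD[OF g imageI[OF that]] \<theta> by (simp add: H_def_trcl)
    then have "{g x} \<union> trcl (g x) \<lesssim> elts u"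
      using inf_u by (intro Un_lepoll_infinite) (auto intro: finite_lepoll_infinite)
    then show ?thesis by simp
  qed
  then have "?T \<lesssim> elts u"
    using \<alpha>u inf_u by (intro Un_lepoll_infinite UN_lepoll_infinite)
  then have "with_pairs (with_pairs ?T) \<prec> elts \<theta>"
    using inf_u \<theta> by (simp add: with_pairs_lepoll)
  moreover have "elts (mkfun \<alpha> g) \<subseteq> with_pairs (with_pairs ?T)"
    by (auto intro!: vpair_in_with_pairs)
  ultimately show ?thesis
    using H_I tr by blast
qed

text \<open>A set of conditions closed under \<open>E\<close> is the trace of its own Skolem hull.\<close>

lemma good_function:
  assumes P: "forcing P" and proper: "strongly_proper \<kappa> P"
  obtains E where "\<And>s. E s \<in> conds P"
    "\<And>A. A \<subseteq> conds P \<Longrightarrow> A \<noteq> {} \<Longrightarrow> A \<lesssim> K \<Longrightarrow> E ` seqs \<kappa> A \<subseteq> A \<Longrightarrow> good_set P A"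
proof -
  obtain C R where P_eq: "P = vpair C R"
    using P forcing_def by metis
  obtain p0 where p0: "p0 \<in> conds P"
    using P unfolding forcing_def by blast
  \<comment> \<open>\<open>\<theta>\<close> will be the next cardinal after the size of
    \<open>trcl P \<union> K\<close>, which puts \<open>P\<close>, its conditions and the elements
    of \<open>\<kappa>\<close> into \<open>H \<theta>\<close>.\<close>
  obtain u where u: "elts u = trcl P \<union> K"
    using is_set_Un[OF is_set_trcl is_set_elts] is_set_def by metis
  obtain \<theta> :: 'v where \<theta>: "cardinal \<theta>" "\<And>Y::'v set. Y \<prec> elts \<theta> \<longleftrightarrow> Y \<lesssim> elts u"
    using Hartogs[of u] by metis
  let ?N = "H \<theta>"
  have Ku: "K \<lesssim> elts u"
    by (simp add: u subset_imp_lepoll)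
  have PN: "P \<in> ?N"
    using \<theta>(2) by (simp add: H_def_trcl u subset_imp_lepoll)
  have condsN: "conds P \<subseteq> ?N"
  proof -
    have "vset {C, R} \<in> ?N"
      using trans_class_H[of \<theta>] PN unfolding trans_class_def P_eq vpair_def by auto
    then have "C \<in> ?N"
      using trans_class_H[of \<theta>] unfolding trans_class_def by auto
    then show ?thesis
      using trans_class_H[of \<theta>] by (auto simp: trans_class_def P_eq)
  qed
  have KN: "K \<subseteq> ?N"
    using lepoll_trans[OF subset_imp_lepoll Ku, of "trcl _"] \<theta>(2)
      trcl_subset_trans_class[OF trans_class_ordinal[OF ord]] ordinal_trans[OF ord]
    by (auto simp: H_def_trcl)
  \<comment> \<open>Skolem values make the hull elementary, and sequences make it \<kappa>-closed.
    The default value \<open>P\<close> is in the hull from the start.\<close>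
  define \<Phi> where "\<Phi> B = {x. finite B \<and> (\<exists>\<phi> i xs. set xs \<subseteq> B \<and> x = skolem ?N P \<phi> i xs)} \<union> seqs \<kappa> B" for B
  define Hull where "Hull X = cl \<kappa> \<Phi> ((K \<union> {P}) \<union> X)" for X
  have \<Phi>_N: "\<Phi> B \<subseteq> ?N" if "B \<subseteq> ?N" for B
    using that skolem_in[OF PN] mkfun_in_H[OF \<theta>(2) Ku] unfolding \<Phi>_def
    by (auto elim!: seqsE)
  have Hull_N: "Hull X \<subseteq> ?N" if "X \<subseteq> ?N" for X
    unfolding Hull_def using \<Phi>_N KN PN that by (intro cl_subset) auto
  \<comment> \<open>Formulas, variables and lists over a finite set are countable, and sequences are
    counted by \<kappa>^{<\<kappa>} = \<kappa>.\<close>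
  have \<Phi>_K: "\<Phi> B \<lesssim> K" if "B \<prec> K" for B
  proof -
    have "{x. finite B \<and> (\<exists>\<phi> i xs. set xs \<subseteq> B \<and> x = skolem ?N P \<phi> i xs)}
        \<subseteq> (if finite B then (\<lambda>(\<phi>, i, xs). skolem ?N P \<phi> i xs) ` (UNIV \<times> UNIV \<times> lists B) else {})"
      by (auto simp: lists_eq_set intro!: image_eqI[where f = "\<lambda>(\<phi>, i, xs). skolem ?N P \<phi> i xs"])
    moreover have "countable (if finite B then (\<lambda>(\<phi>, i, xs). skolem ?N P \<phi> i xs) ` (UNIV \<times> UNIV \<times> lists B) else {})"
      by (auto intro!: countable_image countable_SIGMA countable_lists intro: countable_finite)
    ultimately have "countable {x. finite B \<and> (\<exists>\<phi> i xs. set xs \<subseteq> B \<and> x = skolem ?N P \<phi> i xs)}"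
      by (rule countable_subset)
    then show ?thesis
      unfolding \<Phi>_def using inf that
      by (intro Un_lepoll_infinite countable_lepoll_infinite seqs_lepoll lesspoll_imp_lepoll)
  qed
  have Hull_K: "Hull X \<lesssim> K" if "X \<lesssim> K" for X
    unfolding Hull_def
  proof (rule cl_lepoll[OF ord inf bounded inf lepoll_refl small_subsets_lepoll \<Phi>_K])
    show "K \<union> {P} \<union> X \<lesssim> K"
      using that inf by (intro Un_lepoll_infinite) (auto intro: finite_lepoll_infinite)
  qed
  have Hull_closed: "\<Phi> B \<subseteq> Hull X" if "B \<subseteq> Hull X" "B \<prec> K" for B X
    using that cl_closed unfolding Hull_def by blast
  have Hull_base: "K \<subseteq> Hull X" "P \<in> Hull X" "X \<subseteq> Hull X" for X
    by (auto simp: Hull_def intro: cl.base)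
  \<comment> \<open>The hull is a \<kappa>-closed elementary submodel of size \<kappa> that contains
    \<open>P\<close>, so strong properness applies to it.\<close>
  have Hull_good: "good_set P (conds P \<inter> Hull X)" if X: "X \<subseteq> conds P" "X \<lesssim> K" for X
  proof -
    let ?M = "Hull X"
    have "elementary ?M ?N"
    proof (rule elementary_if_skolem_closed[OF Hull_N Hull_base(2)])
      show "X \<subseteq> ?N" using X(1) condsN by blast
      fix \<phi> i xs assume "set xs \<subseteq> ?M"
      moreover have "skolem ?N P \<phi> i xs \<in> \<Phi> (set xs)"
        by (auto simp: \<Phi>_def)
      ultimately show "skolem ?N P \<phi> i xs \<in> ?M"
        using Hull_closed[of "set xs" X] finite_lesspoll by blast
    qed
    moreover have "closed_under_seqs \<kappa> ?M"
      unfolding closed_under_seqs_iff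
    proof
      fix f assume "f \<in> seqs \<kappa> ?M"
      then obtain \<alpha> g where f: "\<alpha> \<in> K" "g ` elts \<alpha> \<subseteq> ?M" "f = mkfun \<alpha> g"
        by (rule seqsE)
      have "g ` elts \<alpha> \<prec> K"
        using image_lepoll mem_lesspoll[OF f(1)] by (rule lesspoll_trans1)
      moreover have "f \<in> \<Phi> (g ` elts \<alpha>)"
        using f by (auto simp: \<Phi>_def intro: seqsI)
      ultimately show "f \<in> ?M"
        using Hull_closed[OF f(2)] by blast
    qed
    moreover have "?M \<approx> K"
      using lepoll_antisym[OF Hull_K[OF X(2)] subset_imp_lepoll[OF Hull_base(1)]] .
    ultimately have "\<exists>q. le P q p \<and> strongly_generic ?M P q" if "p \<in> conds P \<inter> ?M" for p
      using proper \<theta>(1) Hull_base(2) that unfolding strongly_proper_def by blast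
    then show ?thesis
      unfolding good_set_def using strongly_generic_Int by blast
  qed
  \<comment> \<open>A small nonempty \<open>a\<close> has at least \<kappa> enumerations, enough to
    index the trace of its hull. A sequence thus determines both its range \<open>a\<close> and an
    index, which lets one function list the traces of all these hulls.\<close>
  have "\<exists>e. (\<forall>s. e s \<in> conds P) \<and> (a \<noteq> {} \<longrightarrow> conds P \<inter> Hull a \<subseteq> e ` {f \<in> seqs \<kappa> a. vran f = a})"
    if a: "a \<subseteq> conds P" "a \<prec> K" for a
  proof -
    let ?S = "{f \<in> seqs \<kappa> a. vran f = a}"
    have "\<exists>e. conds P \<inter> Hull a \<subseteq> e ` ?S" if "a \<noteq> {}"
    proof -
      have "conds P \<inter> Hull a \<lesssim> Hull a"
        by (simp add: subset_imp_lepoll)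
      also have "\<dots> \<lesssim> K"
        using a(2) by (intro Hull_K lesspoll_imp_lepoll)
      also have "K \<lesssim> ?S"
        using a(2) that by (rule many_enumerations)
      finally show ?thesis
        by (simp add: lepoll_iff)
    qed
    then obtain e where e: "a \<noteq> {} \<Longrightarrow> conds P \<inter> Hull a \<subseteq> e ` ?S"
      by blast
    have "a \<noteq> {} \<Longrightarrow> conds P \<inter> Hull a \<subseteq> (\<lambda>s. if e s \<in> conds P then e s else p0) ` ?S"
      using e by fastforce
    then show ?thesis
      using p0 by (intro exI[of _ "\<lambda>s. if e s \<in> conds P then e s else p0"]) auto
  qed
  then obtain e where e: "\<And>a s. a \<subseteq> conds P \<Longrightarrow> a \<prec> K \<Longrightarrow> e a s \<in> conds P"
    "\<And>a. a \<subseteq> conds P \<Longrightarrow> a \<prec> K \<Longrightarrow> a \<noteq> {} \<Longrightarrow>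
      conds P \<inter> Hull a \<subseteq> e a ` {f \<in> seqs \<kappa> a. vran f = a}"
    by metis
  define E where "E s = (if vran s \<subseteq> conds P \<and> vran s \<prec> K then e (vran s) s else p0)" for s
  have "E s \<in> conds P" for s
    using e(1) p0 by (simp add: E_def)
  moreover have "good_set P A"
    if A: "A \<subseteq> conds P" "A \<noteq> {}" "A \<lesssim> K" and closed: "E ` seqs \<kappa> A \<subseteq> A" for A
  proof -
    \<comment> \<open>By \<open>cl_support\<close> an element of the hull lies in the hull of a
      small subset of \<open>A\<close>, and \<open>E\<close> lists the trace of that hull. The
      element \<open>y\<close> is inserted because the empty set has too few enumerations.\<close>
    have "conds P \<inter> Hull A \<subseteq> A"
    proof
      fix x assume x: "x \<in> conds P \<inter> Hull A"
      then obtain a where a: "a \<subseteq> A" "a \<prec> K" "x \<in> Hull a"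
        using cl_support[of x \<Phi> "K \<union> {P}" A] unfolding Hull_def by blast
      obtain y where "y \<in> A"
        using A(2) by blast
      let ?a = "insert y a"
      have a': "?a \<subseteq> A" "?a \<prec> K" "x \<in> Hull ?a"
      proof -
        show "?a \<subseteq> A" using a(1) \<open>y \<in> A\<close> by blast
        show "?a \<prec> K"
          using small_UN[of "{True, False}" "\<lambda>b. if b then {y} else a"] a(2)
          by (auto simp: finite_lesspoll)
        show "x \<in> Hull ?a"
          using a(3) cl_mono[of "K \<union> {P} \<union> a" "K \<union> {P} \<union> ?a"] unfolding Hull_def by blast
      qed
      then obtain f where f: "f \<in> seqs \<kappa> ?a" "vran f = ?a" "x = e ?a f"
        using e(2)[of ?a] x A(1) by blast
      then have "x = E f"
        using a'(2) subset_trans[OF a'(1) A(1)] by (simp add: E_def)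
      moreover have "f \<in> seqs \<kappa> A"
        using f(1) seqs_mono[OF a'(1)] by blast
      ultimately show "x \<in> A"
        using closed by blast
    qed
    then have "conds P \<inter> Hull A = A"
      using A(1) Hull_base(3)[of A] by blast
    then show ?thesis
      using Hull_good[OF A(1,3)] by simp
  qed
  ultimately show ?thesis
    using that by blast
qed

end

section \<open>Formulas over transitive classes\<close>

text \<open>Bound variables of the formulas below are chosen above all parameters, which makes them fresh.\<close>

definition fAll :: "nat \<Rightarrow> fm \<Rightarrow> fm" where
  "fAll i \<phi> = FNeg (FEx i (FNeg \<phi>))"

definition fImp :: "fm \<Rightarrow> fm \<Rightarrow> fm" where
  "fImp \<phi> \<psi> = FNeg (FConj \<phi> (FNeg \<psi>))"

definition fSub :: "nat \<Rightarrow> nat \<Rightarrow> fm" where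
  "fSub x y = (let u = Suc (x + y) in fAll u (fImp (FMem u x) (FMem u y)))"

definition fDoubleton :: "nat \<Rightarrow> nat \<Rightarrow> nat \<Rightarrow> fm" where
  "fDoubleton w x y = (let u = Suc (w + x + y) in
    FConj (FMem x w) (FConj (FMem y w)
      (fAll u (fImp (FMem u w) (FNeg (FConj (FNeg (FEq u x)) (FNeg (FEq u y))))))))"

definition fPair :: "nat \<Rightarrow> nat \<Rightarrow> nat \<Rightarrow> fm" where
  "fPair z x y = (let a = Suc (z + x + y); b = Suc a in
    FEx a (FEx b (FConj (fDoubleton a x x) (FConj (fDoubleton b x y) (fDoubleton z a b)))))"

definition fApp :: "nat \<Rightarrow> nat \<Rightarrow> nat \<Rightarrow> fm" where
  "fApp f x y = (let z = Suc (f + x + y) in FEx z (FConj (FMem z f) (fPair z x y)))"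

definition fTrans :: "nat \<Rightarrow> fm" where
  "fTrans x = fAll (Suc x) (fImp (FMem (Suc x) x) (fSub (Suc x) x))"

definition fOrd :: "nat \<Rightarrow> fm" where
  "fOrd x = FConj (fTrans x) (fAll (Suc x) (fImp (FMem (Suc x) x) (fTrans (Suc x))))"

definition fOnto :: "nat \<Rightarrow> nat \<Rightarrow> nat \<Rightarrow> fm" where
  "fOnto t b a = (let x = Suc (t + b + a); y = Suc x; z = Suc y in
    FConj (fAll y (fImp (FMem y a) (FEx x (FConj (FMem x b) (fApp t x y)))))
      (fAll x (fAll y (fAll z (fImp (FConj (fApp t x y) (fApp t x z)) (FEq y z))))))"

definition fFun :: "nat \<Rightarrow> nat \<Rightarrow> nat \<Rightarrow> fm" where
  "fFun f a b = (let x = Suc (f + a + b); y = Suc x; z = Suc y in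
    FConj (fAll z (fImp (FMem z f) (FEx x (FEx y (FConj (FMem x a) (FConj (FMem y b) (fPair z x y)))))))
      (fAll x (fImp (FMem x a)
        (FEx y (FConj (fApp f x y) (fAll z (fImp (fApp f x z) (FEq z y))))))))"

text \<open>The pairs in \<open>t\<close> form a partial function whose domain is not tied to
  \<open>b\<close>; this is enough for comparing sizes.\<close>

definition onto :: "'v::zfc \<Rightarrow> 'v \<Rightarrow> 'v \<Rightarrow> bool" where
  "onto t b a \<longleftrightarrow> (\<forall>y\<in>elts a. \<exists>x\<in>elts b. vpair x y \<in> elts t) \<and>
    (\<forall>x y z. vpair x y \<in> elts t \<longrightarrow> vpair x z \<in> elts t \<longrightarrow> y = z)"

text \<open>A comparison of \<open>c\<close> with 2 to the size of \<open>l\<close> that avoids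
  naming the power set: \<open>w\<close> may be any set of subsets of \<open>l\<close>.\<close>

definition fPow_onto :: "nat \<Rightarrow> nat \<Rightarrow> fm" where
  "fPow_onto l c = (let w = Suc (l + c); f = Suc w; u = Suc f in
    FEx w (FEx f (FConj (fAll u (fImp (FMem u w) (fSub u l))) (fOnto f w c))))"

lemma onto_lepoll: "onto t b a \<Longrightarrow> elts a \<lesssim> elts b"
  by (rule lepoll_relational_full[where R = "\<lambda>x y. vpair x y \<in> elts t"]) (auto simp: onto_def)

definition env :: "'v set \<Rightarrow> (nat \<Rightarrow> 'v) \<Rightarrow> bool" where
  "env N s \<longleftrightarrow> (\<forall>n. s n \<in> N)"

lemma env_upd [simp]: "env N s \<Longrightarrow> a \<in> N \<Longrightarrow> env N (s(i := a))"
  by (simp add: env_def)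

lemma envD [simp]: "env N s \<Longrightarrow> s n \<in> N"
  by (simp add: env_def)

lemma sat_fAll [simp]: "sat N s (fAll i \<phi>) \<longleftrightarrow> (\<forall>a\<in>N. sat N (s(i := a)) \<phi>)"
  by (simp add: fAll_def)

lemma sat_fImp [simp]: "sat N s (fImp \<phi> \<psi>) \<longleftrightarrow> (sat N s \<phi> \<longrightarrow> sat N s \<psi>)"
  by (simp add: fImp_def)

text \<open>Formulas with bounded quantifiers are absolute for a transitive class. Quantifiers over
  \<open>N\<close> survive in the evaluation lemmas only for objects that cannot be reached from the
  parameters by membership, such as \<open>w\<close> and \<open>f\<close> in
  \<open>fPow_onto\<close>.\<close>

locale transitive_model =
  fixes N :: "'v::zfc set"
  assumes trans_N: "trans_class N"
begin

lemma mem_N: "y \<in> elts x \<Longrightarrow> x \<in> N \<Longrightarrow> y \<in> N"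
  using trans_N by (auto simp: trans_class_def)

lemma vpair_N: "vpair x y \<in> N \<Longrightarrow> x \<in> N \<and> y \<in> N \<and> vset {x} \<in> N \<and> vset {x, y} \<in> N"
  using mem_N[of "vset {x, y}" "vpair x y"] mem_N[of "vset {x}" "vpair x y"]
    mem_N[of x "vset {x, y}"] mem_N[of y "vset {x, y}"]
  by (simp add: vpair_def)

lemma vpair_mem_N: "vpair x y \<in> elts f \<Longrightarrow> f \<in> N \<Longrightarrow> x \<in> N \<and> y \<in> N \<and> vpair x y \<in> N"
  using vpair_N mem_N by blast

lemma bounded_quantifiers:
  assumes "x \<in> N"
  shows "(\<exists>a\<in>N. a \<in> elts x \<and> Q a) \<longleftrightarrow> (\<exists>a\<in>elts x. Q a)"
    "(\<forall>a\<in>N. a \<in> elts x \<longrightarrow> Q a) \<longleftrightarrow> (\<forall>a\<in>elts x. Q a)"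
    "(\<forall>a\<in>N. a \<in> elts x \<and> R a \<longrightarrow> Q a) \<longleftrightarrow> (\<forall>a\<in>elts x. R a \<longrightarrow> Q a)"
  using mem_N[OF _ assms] by blast+

lemma sat_fSub [simp]:
  assumes "env N s"
  shows "sat N s (fSub x y) \<longleftrightarrow> elts (s x) \<subseteq> elts (s y)"
  using assms mem_N[of _ "s x"] by (auto simp: fSub_def Let_def)

lemma sat_fDoubleton [simp]:
  assumes "env N s"
  shows "sat N s (fDoubleton w x y) \<longleftrightarrow> s w = vset {s x, s y}"
proof -
  have "sat N s (fDoubleton w x y) \<longleftrightarrow> elts (s w) = {s x, s y}"
    using assms mem_N[of _ "s w"] by (auto simp: fDoubleton_def Let_def)
  also have "\<dots> \<longleftrightarrow> s w = vset {s x, s y}"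
    by (metis elts_vset_doubleton elts_vset_elts)
  finally show ?thesis .
qed

lemma sat_fPair [simp]:
  assumes "env N s"
  shows "sat N s (fPair z x y) \<longleftrightarrow> s z = vpair (s x) (s y)"
proof -
  have "sat N s (fPair z x y) \<longleftrightarrow>
      (\<exists>a\<in>N. \<exists>b\<in>N. a = vset {s x, s x} \<and> b = vset {s x, s y} \<and> s z = vset {a, b})"
    using assms by (simp add: fPair_def Let_def)
  also have "\<dots> \<longleftrightarrow> s z = vpair (s x) (s y)"
    using vpair_N[of "s x" "s y"] envD[OF assms, of z] by (auto simp: vpair_def)
  finally show ?thesis .
qed

lemma sat_fApp [simp]:
  assumes "env N s"
  shows "sat N s (fApp f x y) \<longleftrightarrow> vpair (s x) (s y) \<in> elts (s f)"
  using assms mem_N[of _ "s f"] by (auto simp: fApp_def Let_def)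

lemma sat_fTrans [simp]:
  assumes "env N s"
  shows "sat N s (fTrans x) \<longleftrightarrow> transitive (s x)"
  using assms mem_N[of _ "s x"] by (auto simp: fTrans_def transitive_def)

lemma sat_fOrd [simp]:
  assumes "env N s"
  shows "sat N s (fOrd x) \<longleftrightarrow> ordinal (s x)"
  using assms mem_N[of _ "s x"] by (auto simp: fOrd_def ordinal_def)

lemma sat_fOnto [simp]:
  assumes "env N s"
  shows "sat N s (fOnto t b a) \<longleftrightarrow> onto (s t) (s b) (s a)"
proof -
  have "sat N s (fOnto t b a) \<longleftrightarrow>
      (\<forall>y\<in>N. y \<in> elts (s a) \<longrightarrow> (\<exists>x\<in>N. x \<in> elts (s b) \<and> vpair x y \<in> elts (s t))) \<and>
      (\<forall>x\<in>N. \<forall>y\<in>N. \<forall>z\<in>N. vpair x y \<in> elts (s t) \<and> vpair x z \<in> elts (s t) \<longrightarrow> y = z)"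
    using assms by (simp add: fOnto_def Let_def)
  also have "\<dots> \<longleftrightarrow> onto (s t) (s b) (s a)"
    using mem_N[OF _ envD[OF assms]] vpair_mem_N[OF _ envD[OF assms]] unfolding onto_def by meson
  finally show ?thesis .
qed

lemma sat_fFun [simp]:
  assumes "env N s"
  shows "sat N s (fFun f a b) \<longleftrightarrow> vfun (s f) (s a) (elts (s b))"
proof -
  note N = mem_N[OF _ envD[OF assms]] vpair_mem_N[OF _ envD[OF assms]]
  have "sat N s (fFun f a b) \<longleftrightarrow>
      (\<forall>z\<in>N. z \<in> elts (s f) \<longrightarrow>
        (\<exists>x\<in>N. \<exists>y\<in>N. x \<in> elts (s a) \<and> y \<in> elts (s b) \<and> z = vpair x y)) \<and>
      (\<forall>x\<in>N. x \<in> elts (s a) \<longrightarrow> (\<exists>y\<in>N. vpair x y \<in> elts (s f) \<and>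
        (\<forall>z\<in>N. vpair x z \<in> elts (s f) \<longrightarrow> z = y)))"
    using assms by (simp add: fFun_def Let_def)
  also have "\<dots> \<longleftrightarrow> elts (s f) \<subseteq> {vpair x y | x y. x \<in> elts (s a) \<and> y \<in> elts (s b)} \<and>
      (\<forall>x\<in>elts (s a). \<exists>!y. vpair x y \<in> elts (s f))"
  proof (rule arg_cong2[where f = "(\<and>)"])
    show "(\<forall>z\<in>N. z \<in> elts (s f) \<longrightarrow>
        (\<exists>x\<in>N. \<exists>y\<in>N. x \<in> elts (s a) \<and> y \<in> elts (s b) \<and> z = vpair x y)) \<longleftrightarrow>
      elts (s f) \<subseteq> {vpair x y | x y. x \<in> elts (s a) \<and> y \<in> elts (s b)}"
      using N by blast
    show "(\<forall>x\<in>N. x \<in> elts (s a) \<longrightarrow> (\<exists>y\<in>N. vpair x y \<in> elts (s f) \<and>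
        (\<forall>z\<in>N. vpair x z \<in> elts (s f) \<longrightarrow> z = y))) \<longleftrightarrow>
      (\<forall>x\<in>elts (s a). \<exists>!y. vpair x y \<in> elts (s f))"
      using N by (meson)
  qed
  finally show ?thesis
    by (simp add: vfun_def)
qed

lemma sat_fPow_onto [simp]:
  assumes "env N s"
  shows "sat N s (fPow_onto l c) \<longleftrightarrow>
    (\<exists>w\<in>N. \<exists>f\<in>N. (\<forall>u\<in>elts w. elts u \<subseteq> elts (s l)) \<and> onto f w (s c))"
proof -
  have "sat N s (fPow_onto l c) \<longleftrightarrow>
    (\<exists>w\<in>N. \<exists>f\<in>N. (\<forall>u\<in>N. u \<in> elts w \<longrightarrow> elts u \<subseteq> elts (s l)) \<and> onto f w (s c))"
    using assms by (simp add: fPow_onto_def Let_def)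
  then show ?thesis
    using mem_N by meson
qed

end

lemma pow_onto_lepoll:
  assumes "\<forall>u\<in>elts w. elts u \<subseteq> X" "onto f w c"
  shows "elts c \<lesssim> Pow X"
proof -
  have "elts ` elts w \<subseteq> Pow X"
    using assms(1) by blast
  moreover have "inj_on elts (elts w)"
    by (simp add: inj_on_def extensionality)
  ultimately have "elts w \<lesssim> Pow X"
    unfolding lepoll_def by blast
  with onto_lepoll[OF assms(2)] show ?thesis
    by (rule lepoll_trans)
qed

text \<open>The free variables of the formulas below are 1 and 2 for the underlying set and the order of a
  forcing notion, 3 for \<open>\<kappa>\<close>, 4 for a function on the sequences of length less than \<open>\<kappa>\<close>, and 5 for a
  set of conditions.\<close>

definition fLeast_pow :: fm where
  "fLeast_pow = FConj (fOrd 3) (FConj (fPow_onto 3 1)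
    (fAll 5 (fImp (FMem 5 3) (FNeg (fPow_onto 5 1)))))"

definition fGood :: fm where
  "fGood = fAll 7 (fImp (FMem 7 5) (FEx 8 (FConj (FMem 8 1) (FConj (fApp 2 8 7)
    (fAll 9 (fImp (FConj (FMem 9 1) (fApp 2 9 8)) (FEx 10 (FConj (FMem 10 5)
      (fAll 11 (fImp (FConj (FMem 11 5) (fApp 2 11 10)) (FEx 12 (FConj (FMem 12 1)
        (FConj (fApp 2 12 11) (fApp 2 12 9))))))))))))))"

text \<open>Variable 4 is treated as a relation: neither totality nor single-valuedness is demanded,
  only that a sequence in 5 with some value in 1 also has a value in 5.\<close>

definition fClosed :: fm where
  "fClosed = fAll 7 (fImp (FMem 7 3) (fAll 8 (fImp
    (FConj (fFun 8 7 5) (FEx 9 (FConj (FMem 9 1) (fApp 4 8 9))))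
    (FEx 9 (FConj (FMem 9 5) (fApp 4 8 9))))))"

definition fClosed_good :: fm where
  "fClosed_good = fAll 5 (fImp (FConj (fSub 5 1) (FConj (FEx 6 (FMem 6 5))
    (FConj (FEx 6 (fOnto 6 3 5)) fClosed))) fGood)"

context transitive_model
begin

lemma sat_fGood:
  assumes s: "env N s" and sub: "elts (s 5) \<subseteq> elts (s 1)"
  shows "sat N s fGood \<longleftrightarrow> good_set (vpair (s 1) (s 2)) (elts (s 5))"
proof -
  let ?le = "\<lambda>q p. vpair q p \<in> elts (s 2)"
  have "sat N s fGood \<longleftrightarrow>
    (\<forall>p\<in>N. p \<in> elts (s 5) \<longrightarrow> (\<exists>q\<in>N. q \<in> elts (s 1) \<and> ?le q p \<and>
      (\<forall>q'\<in>N. q' \<in> elts (s 1) \<and> ?le q' q \<longrightarrow> (\<exists>\<pi>\<in>N. \<pi> \<in> elts (s 5) \<and>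
        (\<forall>r\<in>N. r \<in> elts (s 5) \<and> ?le r \<pi> \<longrightarrow>
          (\<exists>u\<in>N. u \<in> elts (s 1) \<and> ?le u r \<and> ?le u q'))))))"
    using s by (simp add: fGood_def)
  also have "\<dots> \<longleftrightarrow>
    (\<forall>p\<in>elts (s 5). \<exists>q\<in>elts (s 1). ?le q p \<and>
      (\<forall>q'\<in>elts (s 1). ?le q' q \<longrightarrow> (\<exists>\<pi>\<in>elts (s 5).
        (\<forall>r\<in>elts (s 5). ?le r \<pi> \<longrightarrow> (\<exists>u\<in>elts (s 1). ?le u r \<and> ?le u q')))))"
    by (simp only: bounded_quantifiers[OF envD[OF s]])
  also have "\<dots> \<longleftrightarrow> good_set (vpair (s 1) (s 2)) (elts (s 5))"
    using sub by (auto simp: good_set_def strongly_generic_def compatible_def Int_absorb1)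
  finally show ?thesis .
qed

lemma sat_fClosed_good:
  assumes s: "env N s"
  shows "sat N s fClosed_good \<longleftrightarrow>
    (\<forall>A\<in>N. elts A \<subseteq> elts (s 1) \<and> elts A \<noteq> {} \<and> (\<exists>t\<in>N. onto t (s 3) A) \<and>
      (\<forall>\<alpha>\<in>elts (s 3). \<forall>f\<in>N. vfun f \<alpha> (elts A) \<longrightarrow> (\<exists>x\<in>elts (s 1). vpair f x \<in> elts (s 4)) \<longrightarrow>
        (\<exists>x\<in>elts A. vpair f x \<in> elts (s 4))) \<longrightarrow>
      good_set (vpair (s 1) (s 2)) (elts A))"
proof -
  note N = mem_N[OF _ envD[OF s]]
  have "sat N (s(5 := A)) fClosed \<longleftrightarrow>
      (\<forall>\<alpha>\<in>elts (s 3). \<forall>f\<in>N. vfun f \<alpha> (elts A) \<longrightarrow> (\<exists>x\<in>elts (s 1). vpair f x \<in> elts (s 4)) \<longrightarrow>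
        (\<exists>x\<in>elts A. vpair f x \<in> elts (s 4)))" if A: "A \<in> N" for A
  proof -
    have "sat N (s(5 := A)) fClosed \<longleftrightarrow>
      (\<forall>\<alpha>\<in>N. \<alpha> \<in> elts (s 3) \<longrightarrow> (\<forall>f\<in>N. vfun f \<alpha> (elts A) \<and>
        (\<exists>x\<in>N. x \<in> elts (s 1) \<and> vpair f x \<in> elts (s 4)) \<longrightarrow>
        (\<exists>x\<in>N. x \<in> elts A \<and> vpair f x \<in> elts (s 4))))"
      using s A by (simp add: fClosed_def)
    then show ?thesis
      using N mem_N[OF _ A] by meson
  qed
  moreover have "(\<exists>a\<in>N. a \<in> elts A) \<longleftrightarrow> elts A \<noteq> {}" if "A \<in> N" for A
    using mem_N[OF _ that] by blast
  moreover have "sat N (s(5 := A)) fGood \<longleftrightarrow> good_set (vpair (s 1) (s 2)) (elts A)"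
    if "A \<in> N" "elts A \<subseteq> elts (s 1)" for A
    using sat_fGood[of "s(5 := A)"] s that by simp
  ultimately show ?thesis
    using s by (simp add: fClosed_good_def cong: conj_cong)
qed

lemma sat_fLeast_pow:
  assumes s: "env N s"
  shows "sat N s fLeast_pow \<longleftrightarrow> ordinal (s 3) \<and>
    (\<exists>w\<in>N. \<exists>f\<in>N. (\<forall>u\<in>elts w. elts u \<subseteq> elts (s 3)) \<and> onto f w (s 1)) \<and>
    (\<forall>\<alpha>\<in>elts (s 3). \<not> (\<exists>w\<in>N. \<exists>f\<in>N. (\<forall>u\<in>elts w. elts u \<subseteq> elts \<alpha>) \<and> onto f w (s 1)))"
  using s mem_N[OF _ envD[OF s, of 3]] by (simp add: fLeast_pow_def) blast

end

section \<open>Strong properness of forcings of size 2^\<kappa> from such a function\<close>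

context regular_exp
begin

text \<open>A sequence is a set of at most \<kappa> pairs from \<open>K \<times> Y\<close>, so
  \<open>bounded_subsets_lepoll\<close> counts them.\<close>

lemma seqs_lepoll_Pow:
  assumes "Y \<lesssim> Pow K"
  shows "seqs \<kappa> Y \<lesssim> Pow K"
proof -
  let ?Z = "(\<lambda>(x, y). vpair x y) ` (K \<times> Y)"
  have "?Z \<lesssim> K \<times> Y"
    by (rule image_lepoll)
  also have "K \<times> Y \<lesssim> Pow K"
    using inf assms by (intro Times_lepoll_infinite lepoll_Pow_self) auto
  finally have "{B. B \<subseteq> ?Z \<and> B \<lesssim> K} \<lesssim> Pow K"
    by (rule bounded_subsets_lepoll[OF inf])
  moreover have "elts ` seqs \<kappa> Y \<subseteq> {B. B \<subseteq> ?Z \<and> B \<lesssim> K}"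
  proof
    fix B assume "B \<in> elts ` seqs \<kappa> Y"
    then obtain f where "f \<in> seqs \<kappa> Y" "B = elts f"
      by blast
    then obtain \<alpha> g where f: "\<alpha> \<in> K" "g ` elts \<alpha> \<subseteq> Y" "B = (\<lambda>x. vpair x (g x)) ` elts \<alpha>"
      by (auto elim: seqsE)
    have "B \<lesssim> elts \<alpha>"
      unfolding f(3) by (rule image_lepoll)
    then have "B \<lesssim> K"
      using mem_lesspoll[OF f(1)] by (meson lepoll_trans lesspoll_imp_lepoll)
    moreover have "B \<subseteq> ?Z"
      using f ordinal_trans[OF ord f(1)] by (auto simp: image_iff)
    ultimately show "B \<in> {B. B \<subseteq> ?Z \<and> B \<lesssim> K}"
      by blast
  qed
  moreover have "inj_on elts (seqs \<kappa> Y)"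
    by (simp add: inj_on_def extensionality)
  ultimately show ?thesis
    unfolding lepoll_def[of "seqs \<kappa> Y"] by (meson lepoll_def lepoll_trans)
qed

text \<open>All subsets of \<alpha> are among the small subsets of \<kappa>, of which there are at
  most \<kappa>. This makes \<kappa> recoverable from a forcing of size 2^\<kappa>.\<close>

lemma Pow_not_lepoll_Pow_mem:
  assumes "\<alpha> \<in> K"
  shows "\<not> Pow K \<lesssim> Pow (elts \<alpha>)"
proof -
  have "Pow (elts \<alpha>) \<subseteq> {B. B \<subseteq> K \<and> B \<prec> K}"
    using ordinal_trans[OF ord assms] mem_lesspoll[OF assms]
    by (auto intro: lesspoll_trans1 subset_imp_lepoll)
  then have "Pow (elts \<alpha>) \<lesssim> K"
    using small_subsets_lepoll[OF lepoll_refl] by (meson lepoll_trans subset_imp_lepoll)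
  then show ?thesis
    using not_Pow_lepoll lepoll_trans by blast
qed

text \<open>An elementary submodel \<open>M\<close> containing \<open>Q\<close> contains \<open>\<kappa>\<close>, as \<open>\<kappa>\<close> is the least ordinal with
  \<open>elts C \<lesssim> Pow \<kappa>\<close>. Hence \<open>M\<close> also contains a function that witnesses the hypothesis
  on \<open>E\<close>.\<close>

lemma strongly_proper_if_good_function:
  assumes Q: "Q = vpair C R" and C: "elts C \<approx> Pow K"
    and E: "E ` seqs \<kappa> (elts C) \<subseteq> elts C"
    and good: "\<And>A. A \<subseteq> elts C \<Longrightarrow> A \<noteq> {} \<Longrightarrow> A \<lesssim> K \<Longrightarrow> E ` seqs \<kappa> A \<subseteq> A \<Longrightarrow> good_set Q A"
  shows "strongly_proper \<kappa> Q"
  unfolding strongly_proper_def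
proof (intro allI impI ballI)
  fix \<chi> M p
  assume asm: "cardinal \<chi> \<and> closed_under_seqs \<kappa> M \<and> M \<approx> K \<and> elementary M (H \<chi>) \<and> Q \<in> M"
  assume p: "p \<in> conds Q \<inter> M"
  let ?N = "H \<chi>"
  interpret transitive_model ?N
    by unfold_locales (rule trans_class_H)
  have seqs_M: "seqs \<kappa> M \<subseteq> M" and MK: "M \<approx> K" and el: "elementary M ?N" and QM: "Q \<in> M"
    using asm by (auto simp: closed_under_seqs_iff)
  have MN: "M \<subseteq> ?N"
    using el by (simp add: elementary_def)
  have CR_N: "C \<in> ?N" "R \<in> ?N"
    using QM MN vpair_N[of C R] by (auto simp: Q)
  text \<open>All sets needed as witnesses are subsets of the transitive class \<open>B\<close>.\<close>
  define U where "U = trcl Q"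
  have U_less: "U \<prec> elts \<chi>"
    using QM MN by (auto simp: U_def H_def_trcl)
  have CU: "elts C \<subseteq> U"
  proof -
    have "vset {C, R} \<in> U"
      using elts_subset_trcl[of Q] by (auto simp: U_def Q vpair_def)
    then have "C \<in> U"
      using trans_class_trcl[of Q] by (auto simp: trans_class_def U_def)
    then show ?thesis
      using trans_class_trcl[of Q] by (auto simp: trans_class_def U_def)
  qed
  \<comment> \<open>The 2^\<kappa> conditions all lie in the transitive closure of \<open>Q\<close>,
    which is smaller than \<chi>. This leaves room in \<open>H \<chi>\<close> for the sets of size
    2^\<kappa> constructed next.\<close>
  have PowU: "Pow K \<lesssim> U"
    using C CU by (meson eqpoll_imp_lepoll eqpoll_sym lepoll_trans subset_imp_lepoll)
  have KU: "K \<lesssim> U"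
    using lepoll_Pow_self PowU by (rule lepoll_trans)
  have infU: "infinite U"
    using infinite_lepoll[OF KU inf] .
  have CPow: "elts C \<lesssim> Pow K"
    using C by (rule eqpoll_imp_lepoll)
  \<comment> \<open>\<open>B1\<close> holds the pairs that make up sequences of conditions and
    surjections onto sets of conditions; \<open>B\<close> adds the sequences themselves and the
    pairs in the graph of \<open>E\<close>.\<close>
  define B1 where "B1 = with_pairs (with_pairs (U \<union> K \<union> vset ` Pow K))"
  define B where "B = with_pairs (with_pairs (B1 \<union> seqs \<kappa> (elts C)))"
  have elts_vset_K: "elts (vset X) = X" if "X \<subseteq> K" for X
    using is_set_subset[OF is_set_elts that] by simp
  have "trans_class (U \<union> K \<union> vset ` Pow K)"
    using trans_class_trcl[of Q] trans_class_ordinal[OF ord] elts_vset_K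
    unfolding trans_class_def U_def by (auto; blast)
  then have B1_trans: "trans_class B1"
    unfolding B1_def by (intro trans_class_with_pairs)
  have KC_B1: "vpair x y \<in> B1" if "x \<in> K \<union> vset ` Pow K" "y \<in> elts C" for x y
    using that CU unfolding B1_def by (intro vpair_in_with_pairs) auto
  have seqs_B1: "elts f \<subseteq> B1" if f_seq: "f \<in> seqs \<kappa> (elts C)" for f
  proof -
    obtain \<alpha> g where f: "\<alpha> \<in> K" "g ` elts \<alpha> \<subseteq> elts C" "f = mkfun \<alpha> g"
      using f_seq by (rule seqsE)
    show ?thesis
      using f ordinal_trans[OF ord f(1)] KC_B1 by auto
  qed
  have "trans_class (B1 \<union> seqs \<kappa> (elts C))"
    using B1_trans seqs_B1 unfolding trans_class_def by blast
  then have B_trans: "trans_class B"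
    unfolding B_def by (intro trans_class_with_pairs)
  have "seqs \<kappa> (elts C) \<lesssim> U"
    using seqs_lepoll_Pow[OF CPow] PowU by (rule lepoll_trans)
  moreover have "vset ` Pow K \<lesssim> U"
    using image_lepoll PowU by (rule lepoll_trans)
  ultimately have B_U: "B \<lesssim> U"
    unfolding B_def B1_def using infU KU by (intro with_pairs_lepoll Un_lepoll_infinite) auto
  then have B_less: "B \<prec> elts \<chi>"
    using U_less by (rule lesspoll_trans1)
  have set_B: "is_set X" "vset X \<in> ?N" if "X \<subseteq> B" for X
  proof -
    have "is_set B"
      using is_set_lepoll[OF B_U] is_set_trcl[of Q] by (simp add: U_def)
    then show "is_set X"
      using that is_set_subset by blast
    then show "vset X \<in> ?N"
      using H_I[OF B_trans B_less] that by simp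
  qed
  have B1_B: "B1 \<subseteq> B" and seqs_B: "seqs \<kappa> (elts C) \<subseteq> B"
    unfolding B_def with_pairs_def by auto
  have B_N: "B \<subseteq> ?N"
    using set_B[OF order_refl] mem_N[of _ "vset B"] by auto
  have sub_B1: "K \<subseteq> B1" "vset ` Pow K \<subseteq> B1" "elts C \<subseteq> B1"
    unfolding B1_def with_pairs_def using CU by auto
  have seqs_N: "f \<in> ?N" if "f \<in> seqs \<kappa> (elts C)" for f
    using that seqs_B B_N by blast
  \<comment> \<open>The witness is the inverse graph of an injection of \<open>a\<close> into
    \<open>b\<close>, a subset of \<open>B\<close>.\<close>
  have onto_ex: "\<exists>t\<in>?N. onto t b a"
    if ab: "elts a \<lesssim> elts b" "elts b \<subseteq> K \<union> vset ` Pow K" "elts a \<subseteq> elts C" for a b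
  proof -
    obtain h where h: "inj_on h (elts a)" "h ` elts a \<subseteq> elts b"
      using ab(1) unfolding lepoll_def by blast
    let ?T = "(\<lambda>y. vpair (h y) y) ` elts a"
    have T: "?T \<subseteq> B"
    proof
      fix z assume "z \<in> ?T"
      then obtain y where y: "y \<in> elts a" "z = vpair (h y) y"
        by blast
      then have "z \<in> B1"
        using h(2) ab(2,3) by (auto intro!: KC_B1)
      then show "z \<in> B"
        using B1_B by blast
    qed
    have "elts (vset ?T) = ?T"
      using set_B(1)[OF T] by simp
    then have "onto (vset ?T) b a"
      using h by (auto simp: onto_def vpair_inject image_iff inj_on_def image_subset_iff)
    then show ?thesis
      using set_B(2)[OF T] by blast
  qed
  have \<kappa>N: "\<kappa> \<in> ?N"
    using set_B(2)[of K] sub_B1(1) B1_B by (simp add: elts_vset_elts)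
  \<comment> \<open>The components of \<open>Q\<close> are definable from \<open>Q\<close>.
    Elementarity puts a first component into \<open>M\<close>, then a second one, and injectivity of
    pairing identifies them with \<open>C\<close> and \<open>R\<close>.\<close>
  obtain c where c: "c \<in> M" "\<exists>r\<in>?N. Q = vpair c r"
  proof -
    have "env ?N ((\<lambda>_. Q)(1 := C, 2 := R))"
      using CR_N QM MN by (auto simp: env_def)
    then have "sat ?N ((\<lambda>_. Q)(1 := C, 2 := R)) (fPair 0 1 2)"
      by (simp add: Q)
    then have "sat ?N ((\<lambda>_. Q)(1 := C)) (FEx 2 (fPair 0 1 2))"
      unfolding sat.simps using CR_N(2) by blast
    then obtain c where "c \<in> M" "sat ?N ((\<lambda>_. Q)(1 := c)) (FEx 2 (fPair 0 1 2))"
      using elementary_witness[OF el _ CR_N(1), of "\<lambda>_. Q"] QM by blast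
    then obtain r where "r \<in> ?N" "sat ?N ((\<lambda>_. Q)(1 := c, 2 := r)) (fPair 0 1 2)"
      unfolding sat.simps by blast
    moreover from this have "env ?N ((\<lambda>_. Q)(1 := c, 2 := r))"
      using \<open>c \<in> M\<close> QM MN by (auto simp: env_def)
    ultimately show ?thesis
      using that[OF \<open>c \<in> M\<close>] by auto
  qed
  then have CM: "C \<in> M"
    by (auto simp: Q vpair_inject)
  obtain r where "r \<in> M" "Q = vpair C r"
  proof -
    have "env ?N ((\<lambda>_. Q)(1 := C, 2 := R))"
      using CR_N QM MN by (auto simp: env_def)
    then have QC: "sat ?N ((\<lambda>_. Q)(1 := C, 2 := R)) (fPair 0 1 2)"
      by (simp add: Q)
    have QCM: "((\<lambda>_. Q)(1 := C)) n \<in> M" for n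
      using QM CM by simp
    from QC obtain r where "r \<in> M" "sat ?N ((\<lambda>_. Q)(1 := C, 2 := r)) (fPair 0 1 2)"
      using elementary_witness[of M ?N "(\<lambda>_. Q)(1 := C)", OF el QCM CR_N(2)] by blast
    moreover from this have "env ?N ((\<lambda>_. Q)(1 := C, 2 := r))"
      using QM CM MN by (auto simp: env_def)
    ultimately show ?thesis
      using that[of r] by simp
  qed
  then have RM: "R \<in> M"
    by (auto simp: Q vpair_inject)
  define s :: "nat \<Rightarrow> 'v" where "s = (\<lambda>_. Q)(1 := C, 2 := R)"
  have s_M: "s n \<in> M" for n
    using QM CM RM by (simp add: s_def)
  then have env_s: "env ?N s"
    using MN by (auto simp: env_def)
  have s12: "s (Suc 0) = C" "s 2 = R"
    by (simp_all add: s_def)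
  have \<kappa>M: "\<kappa> \<in> M"
  proof -
    let ?onto = "\<lambda>\<alpha>. \<exists>w\<in>?N. \<exists>f\<in>?N. (\<forall>u\<in>elts w. elts u \<subseteq> elts \<alpha>) \<and> onto f w C"
    have sat_iff: "sat ?N (s(3 := l)) fLeast_pow \<longleftrightarrow>
        ordinal l \<and> ?onto l \<and> (\<forall>\<alpha>\<in>elts l. \<not> ?onto \<alpha>)" if "l \<in> ?N" for l
      using sat_fLeast_pow[of "s(3 := l)"] env_s that by (simp add: s12)
    have not_below: "\<not> ?onto \<alpha>" if "\<alpha> \<in> K" for \<alpha>
    proof
      assume "?onto \<alpha>"
      then have "elts C \<lesssim> Pow (elts \<alpha>)"
        using pow_onto_lepoll by blast
      then show False
        using C Pow_not_lepoll_Pow_mem[OF that] eqpoll_sym lepoll_trans1 by blast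
    qed
    have onto_\<kappa>: "?onto \<kappa>"
    proof -
      let ?W = "vset ` Pow K"
      have W: "?W \<subseteq> B" "elts (vset ?W) = ?W"
        using sub_B1(2) B1_B set_B(1)[of ?W] by auto
      have "elts C \<lesssim> ?W"
        using CPow by (simp add: inj_on_image_lepoll_2[OF inj_on_vset_Pow])
      then obtain f where "f \<in> ?N" "onto f (vset ?W) C"
        using onto_ex[of C "vset ?W"] W(2) by auto
      moreover have "\<forall>u\<in>elts (vset ?W). elts u \<subseteq> K"
        using W(2) elts_vset_K by auto
      ultimately show ?thesis
        using set_B(2)[OF W(1)] by blast
    qed
    have "sat ?N (s(3 := \<kappa>)) fLeast_pow"
      using sat_iff[OF \<kappa>N] ord onto_\<kappa> not_below by blast
    then obtain l where l: "l \<in> M" "sat ?N (s(3 := l)) fLeast_pow"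
      using elementary_witness[of M ?N s, OF el s_M \<kappa>N] by blast
    then have l': "ordinal l" "?onto l" "\<forall>\<alpha>\<in>elts l. \<not> ?onto \<alpha>"
      using sat_iff[OF subsetD[OF MN l(1)]] by blast+
    have "l \<notin> K"
      using not_below l'(2) by blast
    moreover have "\<kappa> \<notin> elts l"
      using onto_\<kappa> l'(3) by blast
    ultimately have "l = \<kappa>"
      using ordinal_linear[OF l'(1) ord] by blast
    with l(1) show ?thesis by simp
  qed
  define s' where "s' = s(3 := \<kappa>)"
  have s'_M: "s' n \<in> M" for n
    using s_M \<kappa>M by (simp add: s'_def)
  have s': "s' (Suc 0) = C" "s' 2 = R" "s' 3 = \<kappa>"
    by (simp_all add: s'_def s12)
  let ?closed = "\<lambda>e A. \<forall>\<alpha>\<in>K. \<forall>f\<in>?N. vfun f \<alpha> (elts A) \<longrightarrow>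
    (\<exists>x\<in>elts C. vpair f x \<in> elts e) \<longrightarrow> (\<exists>x\<in>elts A. vpair f x \<in> elts e)"
  have sat_iff: "sat ?N (s'(4 := e)) fClosed_good \<longleftrightarrow>
      (\<forall>A\<in>?N. elts A \<subseteq> elts C \<and> elts A \<noteq> {} \<and> (\<exists>t\<in>?N. onto t \<kappa> A) \<and> ?closed e A \<longrightarrow>
        good_set Q (elts A))" if "e \<in> ?N" for e
  proof -
    have "env ?N (s'(4 := e))"
      using s'_M MN that by (auto simp: env_def)
    from sat_fClosed_good[OF this] show ?thesis
      by (simp add: s' Q)
  qed
  \<comment> \<open>The graph of \<open>E\<close> on the sequences of conditions. It serves to show
    that the formula has a solution in \<open>H \<chi>\<close>, and is not claimed to lie in
    \<open>M\<close>.\<close>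
  let ?Ec = "(\<lambda>f. vpair f (E f)) ` seqs \<kappa> (elts C)"
  have Ec: "?Ec \<subseteq> B"
  proof
    fix z assume "z \<in> ?Ec"
    then obtain f where f: "f \<in> seqs \<kappa> (elts C)" "z = vpair f (E f)"
      by blast
    then have "E f \<in> B1"
      using E sub_B1(3) by blast
    then show "z \<in> B"
      unfolding B_def f(2) using f(1) by (intro vpair_in_with_pairs) auto
  qed
  have "sat ?N (s'(4 := vset ?Ec)) fClosed_good"
    unfolding sat_iff[OF set_B(2)[OF Ec]] elts_vset[OF set_B(1)[OF Ec]]
  proof (intro ballI impI, elim conjE)
    fix A assume "A \<in> ?N" and A: "elts A \<subseteq> elts C" "elts A \<noteq> {}" "\<exists>t\<in>?N. onto t \<kappa> A"
      and closed: "\<forall>\<alpha>\<in>K. \<forall>f\<in>?N. vfun f \<alpha> (elts A) \<longrightarrow>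
        (\<exists>x\<in>elts C. vpair f x \<in> ?Ec) \<longrightarrow> (\<exists>x\<in>elts A. vpair f x \<in> ?Ec)"
    have "E f \<in> elts A" if f: "f \<in> seqs \<kappa> (elts A)" for f
    proof -
      have fC: "f \<in> seqs \<kappa> (elts C)"
        using f seqs_mono[OF A(1)] by blast
      then have "E f \<in> elts C" "vpair f (E f) \<in> ?Ec"
        using E by blast+
      moreover obtain \<alpha> where "\<alpha> \<in> K" "vfun f \<alpha> (elts A)"
        using f by (auto simp: seqs_def)
      ultimately obtain x where "x \<in> elts A" "vpair f x \<in> ?Ec"
        using closed seqs_N[OF fC] by blast
      then show ?thesis
        by (auto simp: vpair_inject)
    qed
    then show "good_set Q (elts A)"
      using good[OF A(1,2)] A(3) onto_lepoll by blast
  qed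
  \<comment> \<open>\<open>e\<close> need not be the graph of \<open>E\<close>; all that is known of
    it is the formula.\<close>
  then obtain e where e: "e \<in> M" "sat ?N (s'(4 := e)) fClosed_good"
    using elementary_witness[of M ?N s', OF el s'_M set_B(2)[OF Ec]] by blast
  let ?A = "elts C \<inter> M"
  have A_B: "?A \<subseteq> B"
    using sub_B1(3) B1_B by blast
  note A_elts = elts_vset[OF set_B(1)[OF A_B]]
  have onto_A: "\<exists>t\<in>?N. onto t \<kappa> (vset ?A)"
  proof (rule onto_ex)
    show "elts (vset ?A) \<lesssim> K"
      unfolding A_elts using MK by (meson inf_le2 lepoll_trans2 subset_imp_lepoll)
  qed (auto simp: A_elts)
  \<comment> \<open>A short sequence in the trace belongs to \<open>M\<close> by \<kappa>-closure.
    If \<open>e\<close> gives it some value in \<open>elts C\<close>, elementarity gives one that is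
    also in \<open>M\<close>.\<close>
  have closed_A: "?closed e (vset ?A)"
    unfolding A_elts
  proof (intro ballI impI)
    fix \<alpha> f assume \<alpha>: "\<alpha> \<in> K" "vfun f \<alpha> ?A" and "\<exists>x\<in>elts C. vpair f x \<in> elts e"
    then obtain x where x: "x \<in> elts C" "vpair f x \<in> elts e"
      by blast
    have "f \<in> seqs \<kappa> ?A"
      using \<alpha> by (auto simp: seqs_def)
    then have fM: "f \<in> M"
      using seqs_mono[of ?A M] seqs_M by blast
    let ?s = "s'(4 := e, 8 := f)"
    have s_M': "?s n \<in> M" for n
      using s'_M e(1) fM by simp
    have env: "env ?N (?s(9 := x))" if "x \<in> ?N" for x
      using s'_M e(1) fM MN that by (auto simp: env_def)
    have "x \<in> ?N"
      using x(1) CR_N(1) mem_N by blast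
    moreover from env[OF this] have "sat ?N (?s(9 := x)) (FConj (FMem 9 1) (fApp 4 8 9))"
      using x by (simp add: s')
    ultimately obtain y where y: "y \<in> M" "sat ?N (?s(9 := y)) (FConj (FMem 9 1) (fApp 4 8 9))"
      using elementary_witness[of M ?N ?s, OF el s_M'] by blast
    then have "y \<in> elts C" "vpair f y \<in> elts e"
      using env[of y] MN by (auto simp: s')
    then show "\<exists>x\<in>?A. vpair f x \<in> elts e"
      using y(1) by blast
  qed
  have "good_set Q (elts (vset ?A))"
  proof (rule bspec[OF iffD1[OF sat_iff e(2)] set_B(2)[OF A_B], THEN mp])
    show "e \<in> ?N"
      using e(1) MN by blast
    have "elts (vset ?A) \<subseteq> elts C" "elts (vset ?A) \<noteq> {}"
      using p by (auto simp: A_elts Q)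
    then show "elts (vset ?A) \<subseteq> elts C \<and> elts (vset ?A) \<noteq> {} \<and>
        (\<exists>t\<in>?N. onto t \<kappa> (vset ?A)) \<and> ?closed e (vset ?A)"
      using onto_A closed_A by (intro conjI)
  qed
  then have "good_set Q ?A"
    by (simp only: A_elts)
  then show "\<exists>q. le Q q p \<and> strongly_generic M Q q"
    using p strongly_generic_Int[of Q M ?A] unfolding good_set_def by (simp add: Q)
qed

section \<open>Reflection of \<open>P\<close> to a forcing of size 2^\<kappa>\<close>

text \<open>A copy of \<open>Pow K\<close> inside \<open>V\<close> is closed under chosen points of
  the members of \<open>\<Delta> B\<close>, for all \<open>B\<close> of size at most \<kappa>. The
  closure takes \<kappa>^+ stages and keeps size 2^\<kappa> since (2^\<kappa>)^\<kappa> =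
  2^\<kappa>.\<close>

lemma reflecting_subset:
  fixes V :: "'v set" and \<Delta> :: "'v set \<Rightarrow> 'v set set"
  assumes V: "Pow K \<lesssim> V" and \<Delta>: "\<And>B. B \<lesssim> K \<Longrightarrow> \<Delta> B \<lesssim> Pow K"
  obtains W where "W \<subseteq> V" "W \<approx> Pow K"
    "\<And>B Z. B \<subseteq> W \<Longrightarrow> B \<lesssim> K \<Longrightarrow> Z \<in> \<Delta> B \<Longrightarrow> Z \<inter> V \<noteq> {} \<Longrightarrow> Z \<inter> W \<noteq> {}"
proof -
  let ?\<mu> = "succ_cardinal \<kappa>"
  note \<mu> = succ_cardinal[OF card]
  obtain j where j: "inj_on j (Pow K)" "j ` Pow K \<subseteq> V"
    using V unfolding lepoll_def by blast
  define pick where "pick Z = (SOME z. z \<in> Z \<inter> V)" for Z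
  have pick: "pick Z \<in> Z \<inter> V" if "Z \<inter> V \<noteq> {}" for Z
    unfolding pick_def by (rule someI_ex) (use that in blast)
  define \<Phi> where "\<Phi> B = pick ` {Z \<in> \<Delta> B. Z \<inter> V \<noteq> {}}" for B
  define W where "W = cl ?\<mu> \<Phi> (j ` Pow K)"
  have "W \<subseteq> V"
    unfolding W_def using j(2) pick by (intro cl_subset) (auto simp: \<Phi>_def)
  moreover have "W \<lesssim> Pow K"
    unfolding W_def
  proof (rule cl_lepoll)
    show "ordinal ?\<mu>"
      using \<mu>(1) by (simp add: cardinal_def)
    have "K \<subseteq> elts ?\<mu>"
      using ordinal_trans[OF \<open>ordinal ?\<mu>\<close> \<mu>(2)] .
    then show "infinite (elts ?\<mu>)"
      using inf infinite_super by blast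
    show "\<exists>j\<in>elts ?\<mu>. B \<subseteq> elts j" if "B \<subseteq> elts ?\<mu>" "B \<prec> elts ?\<mu>" for B
      using succ_cardinal_bounded[OF card inf that] .
    show "infinite (Pow K)"
      using inf by simp
    show "elts ?\<mu> \<lesssim> Pow K"
      by (rule \<mu>(3))
    show "{B. B \<subseteq> Y \<and> B \<prec> elts ?\<mu>} \<lesssim> Pow K" if "Y \<lesssim> Pow K" for Y :: "'v set"
      using bounded_subsets_lepoll[OF inf that] by (simp add: \<mu>(4))
    show "\<Phi> B \<lesssim> Pow K" if "B \<prec> elts ?\<mu>" for B
    proof -
      have "\<Phi> B \<lesssim> {Z \<in> \<Delta> B. Z \<inter> V \<noteq> {}}"
        unfolding \<Phi>_def by (rule image_lepoll)
      also have "\<dots> \<lesssim> \<Delta> B"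
        by (rule subset_imp_lepoll) blast
      also have "\<dots> \<lesssim> Pow K"
        using \<Delta> that \<mu>(4) by blast
      finally show ?thesis .
    qed
    show "j ` Pow K \<lesssim> Pow K"
      by (rule image_lepoll)
  qed
  moreover have "Pow K \<lesssim> W"
  proof -
    have "j ` Pow K \<subseteq> W"
      unfolding W_def by (auto intro: cl.base)
    with j(1) show ?thesis
      unfolding lepoll_def by blast
  qed
  moreover have "Z \<inter> W \<noteq> {}" if "B \<subseteq> W" "B \<lesssim> K" "Z \<in> \<Delta> B" "Z \<inter> V \<noteq> {}" for B Z
  proof -
    have "pick Z \<in> \<Phi> B"
      using that by (auto simp: \<Phi>_def)
    then have "pick Z \<in> W"
      using cl_closed[of B ?\<mu> \<Phi> "j ` Pow K"] that(1,2) \<mu>(4) by (auto simp: W_def)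
    with pick[OF that(4)] show ?thesis
      by blast
  qed
  ultimately show ?thesis
    using that[of W] lepoll_antisym by blast
qed

text \<open>\<open>G\<close> is an arbitrary class here and becomes a generic filter in the
  application, if there is one. The last two conclusions then make its trace on \<open>P'\<close>
  directed and let it meet the dense sets.\<close>

lemma small_reflection:
  fixes P :: 'v
  assumes P: "forcing P" and lattice: "lattice_forcing \<kappa> P" and proper: "strongly_proper \<kappa> P"
    and large: "Pow K \<lesssim> conds P" and T: "T \<lesssim> Pow K"
  obtains P' where "subforcing P' P" "lattice_forcing \<kappa> P'" "strongly_proper \<kappa> P'"
    "conds P' \<approx> Pow K"
    "\<And>\<alpha>. \<alpha> \<in> T \<Longrightarrow> dense_subset P (D \<alpha>) \<Longrightarrow> dense_subset P' (D \<alpha> \<inter> conds P')"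
    "\<And>p q. p \<in> conds P' \<Longrightarrow> q \<in> conds P' \<Longrightarrow> \<exists>r\<in>G. le P r p \<and> le P r q \<Longrightarrow>
      G \<subseteq> conds P \<Longrightarrow> \<exists>r\<in>G \<inter> conds P'. le P r p \<and> le P r q"
    "\<And>\<alpha>. \<alpha> \<in> T \<Longrightarrow> G \<subseteq> conds P \<Longrightarrow> G \<inter> D \<alpha> \<noteq> {} \<Longrightarrow> G \<inter> D \<alpha> \<inter> conds P' \<noteq> {}"
proof -
  obtain C R where P_eq: "P = vpair C R" and
      R: "elts R \<subseteq> {vpair x y | x y. x \<in> elts C \<and> y \<in> elts C}"
    using P unfolding forcing_def by blast
  have conds_P: "conds P = elts C"
    by (simp add: P_eq)
  have le_conds: "x \<in> conds P \<and> y \<in> conds P" if "le P x y" for x y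
    using that R by (auto simp: P_eq vpair_inject)
  have refl: "le P x x" if "x \<in> conds P" for x
    using P that unfolding forcing_def by blast
  have trans: "le P x z" if "le P x y" "le P y z" for x y z
    using P that unfolding forcing_def by blast
  obtain E where E: "\<And>s. E s \<in> conds P"
    "\<And>A. A \<subseteq> conds P \<Longrightarrow> A \<noteq> {} \<Longrightarrow> A \<lesssim> K \<Longrightarrow> E ` seqs \<kappa> A \<subseteq> A \<Longrightarrow> good_set P A"
    using good_function[OF P proper] by blast
  \<comment> \<open>Each member is a set of possible witnesses, of which \<open>W\<close> will
    contain one if there is any in \<open>P\<close>. The singleton \<open>{E s}\<close> forces
    \<open>E s\<close> itself into \<open>W\<close>.\<close>
  define \<Delta> where "\<Delta> B = {{g. is_glb P B g}} \<union> (\<lambda>s. {E s}) ` seqs \<kappa> B \<union>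
      (\<lambda>p. {q. le P q p \<and> strongly_generic B P q}) ` B \<union>
      (\<lambda>(\<alpha>, p). {d \<in> D \<alpha>. le P d p}) ` (T \<times> B) \<union>
      (\<lambda>(p, q). {r \<in> G. le P r p \<and> le P r q}) ` (B \<times> B) \<union> (\<lambda>\<alpha>. G \<inter> D \<alpha>) ` T" for B
  have infPow: "infinite (Pow K)"
    using inf by simp
  have \<Delta>_lepoll: "\<Delta> B \<lesssim> Pow K" if "B \<lesssim> K" for B
  proof -
    have "B \<lesssim> Pow K"
      using that lepoll_Pow_self by (rule lepoll_trans)
    then show ?thesis
      unfolding \<Delta>_def using infPow T
      by (intro Un_lepoll_infinite lepoll_trans[OF image_lepoll] Times_lepoll_infinite seqs_lepoll_Pow)
        (auto intro: finite_lepoll_infinite)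
  qed
  obtain W where W: "W \<subseteq> conds P" "W \<approx> Pow K" and
    refl_W: "\<And>B Z. B \<subseteq> W \<Longrightarrow> B \<lesssim> K \<Longrightarrow> Z \<in> \<Delta> B \<Longrightarrow> Z \<inter> conds P \<noteq> {} \<Longrightarrow> Z \<inter> W \<noteq> {}"
  proof (rule reflecting_subset[OF large \<Delta>_lepoll])
    fix W
    assume "W \<subseteq> conds P" "W \<approx> Pow K"
      "\<And>B Z. B \<subseteq> W \<Longrightarrow> B \<lesssim> K \<Longrightarrow> Z \<in> \<Delta> B \<Longrightarrow> Z \<inter> conds P \<noteq> {} \<Longrightarrow> Z \<inter> W \<noteq> {}"
    then show thesis
      by (rule that)
  qed
  have W_ne: "W \<noteq> {}"
    using W(2) eqpoll_finite_iff infPow by fastforce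
  have fin: "B \<lesssim> K" if "finite B" for B :: "'v set"
    using inf that by (rule finite_lepoll_infinite)
  define C' where "C' = vset W"
  define R' where "R' = vset {z \<in> elts R. \<exists>x\<in>W. \<exists>y\<in>W. z = vpair x y}"
  define P' where "P' = vpair C' R'"
  have C': "elts C' = W"
    using is_set_subset[OF is_set_elts, of W C] W(1) by (simp add: C'_def conds_P)
  have conds_P': "conds P' = W"
    by (simp add: P'_def C')
  have R': "elts R' = {z \<in> elts R. \<exists>x\<in>W. \<exists>y\<in>W. z = vpair x y}"
    unfolding R'_def by (intro elts_vset is_set_subset[OF is_set_elts, of _ R]) blast
  have le': "le P' x y \<longleftrightarrow> x \<in> W \<and> y \<in> W \<and> le P x y" for x y
    by (auto simp: P'_def R' P_eq vpair_inject)
  have P': "forcing P'"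
    unfolding forcing_def
  proof (intro conjI allI impI ballI)
    show "\<exists>C R. P' = vpair C R \<and> elts R \<subseteq> {vpair x y |x y. x \<in> elts C \<and> y \<in> elts C}"
      unfolding P'_def using C' R' by (intro exI[of _ C'] exI[of _ R']) auto
    show "conds P' \<noteq> {}"
      using W_ne by (simp add: conds_P')
    show "le P' p p" if "p \<in> conds P'" for p
      using that refl W(1) by (auto simp: le' conds_P')
    show "le P' p r" if "le P' p q" "le P' q r" for p q r
      using that trans[of p q r] by (simp add: le')
  qed
  have "subforcing P' P"
    unfolding subforcing_def using P P' W(1) by (simp add: conds_P' le')
  moreover have lattice': "\<exists>g. is_glb P X g"
    if "X \<subseteq> W" "X \<prec> K" "\<forall>x\<in>X. \<forall>y\<in>X. compatible P x y" for X
    using lattice[unfolded lattice_forcing_def, THEN spec, of X] that W(1) by simp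
  have glb: "\<exists>g\<in>W. is_glb P X g" if X: "X \<subseteq> W" "X \<lesssim> K" "\<exists>g. is_glb P X g" for X
  proof -
    have "{g. is_glb P X g} \<inter> conds P \<noteq> {}"
      using X(3) by (auto simp: is_glb_def)
    moreover have "{g. is_glb P X g} \<in> \<Delta> X"
      by (simp add: \<Delta>_def)
    ultimately show ?thesis
      using refl_W[OF X(1,2)] by blast
  qed
  \<comment> \<open>Two compatible conditions have a greatest lower bound in \<open>P\<close>, and
    one such bound reflects into \<open>W\<close>. Hence compatibility in \<open>P\<close> passes
    down to \<open>P'\<close>.\<close>
  have compat: "compatible P' x y" if xy: "x \<in> W" "y \<in> W" "compatible P x y" for x y
  proof -
    have "\<forall>a\<in>{x, y}. \<forall>b\<in>{x, y}. compatible P a b"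
      using xy W(1) refl unfolding compatible_def by blast
    then have "\<exists>g. is_glb P {x, y} g"
      using lattice'[of "{x, y}"] finite_lesspoll[of "{x, y}"] xy(1,2) by simp
    then obtain g where "g \<in> W" "is_glb P {x, y} g"
      using glb[of "{x, y}"] xy(1,2) fin by auto
    then show ?thesis
      using xy(1,2) by (auto simp: compatible_def is_glb_def le' conds_P')
  qed
  have "lattice_forcing \<kappa> P'"
    unfolding lattice_forcing_def
  proof (intro allI impI)
    fix X assume X: "X \<subseteq> conds P'" "X \<prec> K" "\<forall>x\<in>X. \<forall>y\<in>X. compatible P' x y"
    then have "\<forall>x\<in>X. \<forall>y\<in>X. compatible P x y"
      unfolding compatible_def using W(1) by (auto simp: le' conds_P'; blast)
    then have "\<exists>g. is_glb P X g"
      using lattice'[of X] X(1,2) by (simp add: conds_P')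
    then obtain g where "g \<in> W" "is_glb P X g"
      using glb[of X] X(1) lesspoll_imp_lepoll[OF X(2)] by (auto simp: conds_P')
    then have "is_glb P' X g"
      using X(1) W(1) unfolding is_glb_def conds_P' le' by blast
    then show "\<exists>g. is_glb P' X g" ..
  qed
  moreover have "strongly_proper \<kappa> P'"
  proof (rule strongly_proper_if_good_function[OF P'_def])
    show "elts C' \<approx> Pow K"
      using W(2) by (simp add: C')
    show "E ` seqs \<kappa> (elts C') \<subseteq> elts C'"
    proof
      fix z assume "z \<in> E ` seqs \<kappa> (elts C')"
      then obtain s where s: "z = E s" "s \<in> seqs \<kappa> W"
        by (auto simp: C')
      obtain \<alpha> g where \<alpha>: "\<alpha> \<in> K" "g ` elts \<alpha> \<subseteq> W" "s = mkfun \<alpha> g"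
        using s(2) by (rule seqsE)
      have "g ` elts \<alpha> \<lesssim> K"
        using image_lepoll lesspoll_imp_lepoll[OF mem_lesspoll[OF \<alpha>(1)]] by (rule lepoll_trans)
      moreover have "{E s} \<in> \<Delta> (g ` elts \<alpha>)"
        using \<alpha>(1,3) by (auto simp: \<Delta>_def intro: seqsI)
      ultimately have "{E s} \<inter> W \<noteq> {}"
        using refl_W[OF \<alpha>(2)] E(1) by blast
      then show "z \<in> elts C'"
        by (simp add: C' s(1))
    qed
    fix A assume A: "A \<subseteq> elts C'" "A \<noteq> {}" "A \<lesssim> K" "E ` seqs \<kappa> A \<subseteq> A"
    then have AW: "A \<subseteq> W"
      by (simp add: C')
    have good: "good_set P A"
      by (rule E(2)[OF subset_trans[OF AW W(1)] A(2-4)])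
    show "good_set P' A"
      unfolding good_set_def
    proof
      fix p assume p: "p \<in> A"
      let ?Z = "{q. le P q p \<and> strongly_generic A P q}"
      have "?Z \<in> \<Delta> A"
        using p by (auto simp: \<Delta>_def)
      moreover have "?Z \<inter> conds P \<noteq> {}"
        using good p le_conds unfolding good_set_def by blast
      ultimately obtain q where q: "q \<in> W" "le P q p" "strongly_generic A P q"
        using refl_W[OF AW A(3)] by blast
      \<comment> \<open>The same \<open>\<pi>\<close> works in \<open>P'\<close>: it lies in
        \<open>A\<close>, and the compatibility it guarantees in \<open>P\<close> is between
        conditions of \<open>W\<close>.\<close>
      have "strongly_generic A P' q"
        unfolding strongly_generic_def conds_P'
      proof (intro conjI ballI impI)
        fix q' assume "q' \<in> W" "le P' q' q"
        then have "q' \<in> conds P" "le P q' q"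
          using W(1) by (auto simp: le')
        then obtain \<pi> where \<pi>: "\<pi> \<in> conds P \<inter> A"
          "\<forall>r\<in>conds P \<inter> A. le P r \<pi> \<longrightarrow> compatible P r q'"
          using q(3) unfolding strongly_generic_def by blast
        have "compatible P' r q'" if "r \<in> W \<inter> A" "le P' r \<pi>" for r
        proof (rule compat)
          show "compatible P r q'"
            using \<pi>(2) that W(1) by (auto simp: le')
        qed (use that \<open>q' \<in> W\<close> in auto)
        then show "\<exists>\<pi>\<in>W \<inter> A. \<forall>r\<in>W \<inter> A. le P' r \<pi> \<longrightarrow> compatible P' r q'"
          using AW \<pi>(1) by blast
      qed (rule q(1))
      then show "\<exists>q. le P' q p \<and> strongly_generic A P' q"
        using q AW p by (auto simp: le')
    qed
  qed
  moreover have "conds P' \<approx> Pow K"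
    using W(2) by (simp add: conds_P')
  moreover have "dense_subset P' (D \<alpha> \<inter> conds P')" if \<alpha>: "\<alpha> \<in> T" and dense: "dense_subset P (D \<alpha>)" for \<alpha>
    unfolding dense_subset_def conds_P'
  proof (intro conjI ballI)
    fix p assume p: "p \<in> W"
    have "{d \<in> D \<alpha>. le P d p} \<in> \<Delta> {p}"
      using \<alpha> by (auto simp: \<Delta>_def)
    moreover have "{d \<in> D \<alpha>. le P d p} \<inter> conds P \<noteq> {}"
      using dense p W(1) unfolding dense_subset_def by blast
    ultimately have "{d \<in> D \<alpha>. le P d p} \<inter> W \<noteq> {}"
      using refl_W[of "{p}"] p fin by blast
    then show "\<exists>d\<in>D \<alpha> \<inter> W. le P' d p"
      using p by (auto simp: le')
  qed auto
  moreover have "\<exists>r\<in>G \<inter> conds P'. le P r p \<and> le P r q"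
    if pq: "p \<in> conds P'" "q \<in> conds P'" "\<exists>r\<in>G. le P r p \<and> le P r q" "G \<subseteq> conds P" for p q
  proof -
    let ?Z = "{r \<in> G. le P r p \<and> le P r q}"
    have "?Z \<in> \<Delta> {p, q}"
      by (auto simp: \<Delta>_def)
    moreover have "?Z \<inter> conds P \<noteq> {}"
      using pq(3,4) by blast
    ultimately have "?Z \<inter> W \<noteq> {}"
      using refl_W[of "{p, q}"] pq(1,2) fin by (auto simp: conds_P')
    then show ?thesis
      by (auto simp: conds_P')
  qed
  moreover have "G \<inter> D \<alpha> \<inter> conds P' \<noteq> {}" if "\<alpha> \<in> T" "G \<subseteq> conds P" "G \<inter> D \<alpha> \<noteq> {}" for \<alpha>
  proof -
    \<comment> \<open>These witnesses depend on no conditions, so the empty set of arguments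
      suffices.\<close>
    have "G \<inter> D \<alpha> \<in> \<Delta> {}"
      using that(1) by (auto simp: \<Delta>_def)
    then show ?thesis
      using refl_W[of "{}" "G \<inter> D \<alpha>"] that(2,3) by (auto simp: conds_P')
  qed
  ultimately show ?thesis
    by (rule that)
qed

end

section \<open>Transfer of generic filters between \<open>P\<close> and \<open>P'\<close>\<close>

lemma generic_filterD:
  assumes "generic_filter Q \<D> G"
  shows "G \<subseteq> conds Q" "G \<noteq> {}" "p \<in> G \<Longrightarrow> q \<in> conds Q \<Longrightarrow> le Q p q \<Longrightarrow> q \<in> G"
    "p \<in> G \<Longrightarrow> q \<in> G \<Longrightarrow> \<exists>r\<in>G. le Q r p \<and> le Q r q" "X \<in> \<D> \<Longrightarrow> G \<inter> X \<noteq> {}"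
  using assms by (simp_all add: generic_filter_def forcing_filter_def)

text \<open>The upward closure in \<open>P\<close> of a filter of \<open>P'\<close> is a filter of
  \<open>P\<close> that includes it, so it still meets every \<open>D \<alpha>\<close>.\<close>

lemma generic_filter_upward:
  assumes sub: "subforcing P' P" and G: "generic_filter P' ((\<lambda>\<alpha>. D \<alpha> \<inter> conds P') ` T) G"
  shows "generic_filter P (D ` T) {p \<in> conds P. \<exists>g\<in>G. le P g p}"
proof -
  have P: "forcing P" and P'_P: "conds P' \<subseteq> conds P"
    and le': "\<And>p q. p \<in> conds P' \<Longrightarrow> q \<in> conds P' \<Longrightarrow> le P' q p \<longleftrightarrow> le P q p"
    using sub by (auto simp: subforcing_def)
  have refl: "\<And>p. p \<in> conds P \<Longrightarrow> le P p p"
    and trans: "\<And>p q r. le P p q \<Longrightarrow> le P q r \<Longrightarrow> le P p r"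
    using P unfolding forcing_def by blast+
  note GP' = generic_filterD(1)[OF G] and ne = generic_filterD(2)[OF G]
    and dir = generic_filterD(4)[OF G]
  have meet: "G \<inter> D \<alpha> \<noteq> {}" if "\<alpha> \<in> T" for \<alpha>
    using generic_filterD(5)[OF G imageI[OF that]] by blast
  have G_sub: "G \<subseteq> {p \<in> conds P. \<exists>g\<in>G. le P g p}"
    using GP' P'_P refl by blast
  show ?thesis
    unfolding generic_filter_def forcing_filter_def
  proof (intro conjI ballI impI)
    show "{p \<in> conds P. \<exists>g\<in>G. le P g p} \<noteq> {}"
      using G_sub ne by blast
    fix p q assume p: "p \<in> {p \<in> conds P. \<exists>g\<in>G. le P g p}"
    {
      assume "q \<in> conds P" "le P p q"
      then show "q \<in> {p \<in> conds P. \<exists>g\<in>G. le P g p}"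
        using p trans by blast
    next
      assume q: "q \<in> {p \<in> conds P. \<exists>g\<in>G. le P g p}"
      obtain g h where gh: "g \<in> G" "le P g p" "h \<in> G" "le P h q"
        using p q by blast
      obtain r where r: "r \<in> G" "le P' r g" "le P' r h"
        using dir[OF gh(1,3)] by blast
      then have "le P r g" "le P r h"
        using le' GP' gh by blast+
      then have "le P r p" "le P r q"
        using trans gh by blast+
      then show "\<exists>r\<in>{p \<in> conds P. \<exists>g\<in>G. le P g p}. le P r p \<and> le P r q"
        using r(1) G_sub by blast
    }
  next
    fix X assume "X \<in> D ` T"
    then show "{p \<in> conds P. \<exists>g\<in>G. le P g p} \<inter> X \<noteq> {}"
      using meet G_sub by blast
  qed blast
qed

text \<open>The size clause is split because a suborder of \<open>P\<close> cannot have 2^\<kappa>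
  conditions when \<open>P\<close> has fewer.\<close>

theorem lemma4p1:
  fixes \<kappa> P :: "'v::zfc" and D :: "'v \<Rightarrow> 'v set"
  assumes "regular_cardinal \<kappa>"
    and "bounded_seqs \<kappa> \<approx> elts \<kappa>"
    and "forcing P"
    and "lattice_forcing \<kappa> P"
    and "strongly_proper \<kappa> P"
    and "\<And>\<alpha>. \<alpha> \<in> elts (succ_cardinal \<kappa>) \<Longrightarrow> dense_subset P (D \<alpha>) \<and> open_subset P (D \<alpha>)"
  shows "\<exists>(P' :: 'v) (D' :: 'v \<Rightarrow> 'v set).
    subforcing P' P \<and>
    lattice_forcing \<kappa> P' \<and>
    strongly_proper \<kappa> P' \<and>
    conds P' \<lesssim> Pow (elts \<kappa>) \<and>
    (Pow (elts \<kappa>) \<lesssim> conds P \<longrightarrow> conds P' \<approx> Pow (elts \<kappa>)) \<and>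
    (\<forall>\<alpha>\<in>elts (succ_cardinal \<kappa>). dense_subset P' (D' \<alpha>)) \<and>
    ((\<exists>G. generic_filter P (D ` elts (succ_cardinal \<kappa>)) G) \<longleftrightarrow>
     (\<exists>G. generic_filter P' (D' ` elts (succ_cardinal \<kappa>)) G))"
proof (cases "conds P \<lesssim> Pow (elts \<kappa>)")
  case True
  have "subforcing P P"
    using assms(3) by (simp add: subforcing_def)
  then show ?thesis
    using assms True by (intro exI[of _ P] exI[of _ D]) (auto intro: lepoll_antisym)
next
  case False
  interpret regular_exp \<kappa>
    by unfold_locales (rule assms)+
  let ?T = "elts (succ_cardinal \<kappa>)"
  note succ = succ_cardinal[OF card]
  \<comment> \<open>The filter is fixed before \<open>P'\<close> is constructed, since the
    conditions of \<open>P'\<close> are chosen with regard to it. If there is none, \<open>G\<close>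
    is an arbitrary class, which \<open>small_reflection\<close> admits.\<close>
  define G where "G = (SOME G. generic_filter P (D ` ?T) G)"
  have large: "Pow (elts \<kappa>) \<lesssim> conds P"
    using False lepoll_linear by blast
  from small_reflection[OF assms(3-5) large succ(3), of D G]
  obtain P' where sub: "subforcing P' P" and P': "lattice_forcing \<kappa> P'" "strongly_proper \<kappa> P'"
      "conds P' \<approx> Pow (elts \<kappa>)"
    and dense: "\<And>\<alpha>. \<alpha> \<in> ?T \<Longrightarrow> dense_subset P (D \<alpha>) \<Longrightarrow> dense_subset P' (D \<alpha> \<inter> conds P')"
    and dir: "\<And>p q. p \<in> conds P' \<Longrightarrow> q \<in> conds P' \<Longrightarrow> \<exists>r\<in>G. le P r p \<and> le P r q \<Longrightarrow>
      G \<subseteq> conds P \<Longrightarrow> \<exists>r\<in>G \<inter> conds P'. le P r p \<and> le P r q"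
    and meet: "\<And>\<alpha>. \<alpha> \<in> ?T \<Longrightarrow> G \<subseteq> conds P \<Longrightarrow> G \<inter> D \<alpha> \<noteq> {} \<Longrightarrow> G \<inter> D \<alpha> \<inter> conds P' \<noteq> {}"
    by blast
  let ?D' = "\<lambda>\<alpha>. D \<alpha> \<inter> conds P'"
  have "generic_filter P' (?D' ` ?T) (G \<inter> conds P')" if "generic_filter P (D ` ?T) G0" for G0
  proof -
    have G: "generic_filter P (D ` ?T) G"
      unfolding G_def using that by (rule someI)
    note GP = generic_filterD(1)[OF G] and up = generic_filterD(3)[OF G]
      and G_dir = generic_filterD(4)[OF G] and G_meet = generic_filterD(5)[OF G imageI]
    have P'_P: "conds P' \<subseteq> conds P"
      and le': "\<And>p q. p \<in> conds P' \<Longrightarrow> q \<in> conds P' \<Longrightarrow> le P' q p \<longleftrightarrow> le P q p"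
      using sub by (auto simp: subforcing_def)
    have meet': "G \<inter> D \<alpha> \<inter> conds P' \<noteq> {}" if "\<alpha> \<in> ?T" for \<alpha>
      using meet[OF that GP G_meet[OF that]] .
    show ?thesis
      unfolding generic_filter_def forcing_filter_def
    proof (intro conjI ballI impI)
      \<comment> \<open>The index \<kappa> is an element of \<kappa>^+, and the trace of
        \<open>G\<close> meets the dense set at that index.\<close>
      show "G \<inter> conds P' \<noteq> {}"
        using meet'[OF succ(2)] by blast
      show "q \<in> G \<inter> conds P'" if "p \<in> G \<inter> conds P'" "q \<in> conds P'" "le P' p q" for p q
        using that up le' P'_P by blast
      show "\<exists>r\<in>G \<inter> conds P'. le P' r p \<and> le P' r q"
        if "p \<in> G \<inter> conds P'" "q \<in> G \<inter> conds P'" for p q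
        using that dir[OF _ _ G_dir GP, of p q] le' by blast
      show "G \<inter> conds P' \<inter> X \<noteq> {}" if "X \<in> ?D' ` ?T" for X
        using that meet' by blast
    qed blast
  qed
  then have "(\<exists>G. generic_filter P (D ` ?T) G) \<longleftrightarrow> (\<exists>G. generic_filter P' (?D' ` ?T) G)"
    using generic_filter_upward[OF sub] by blast
  then show ?thesis
    using sub P' dense assms(6) eqpoll_imp_lepoll
    by (intro exI[of _ P'] exI[of _ ?D']) blast
qed

end
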